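(* Let $a,b$ be integers with $2\le a<b$, let $p,\tilde p>0$ be real, let $q,\tilde q$ be even integers with $2\le q\le b$ and $2\le\tilde q\le a$, and let $$f(x,y)=x^ay^b+x^{a}y^{b-q}e^{-1/|x|^p}+x^{a-\tilde q}y^{b}e^{-1/|y|^{\tilde p}}$$ (with the exponentials set equal to $0$ at $x=0$, respectively $y=0$). Let $U$ be a sufficiently small open neighborhood of the origin in $\mathbb{R}^2$, let $\varphi\in C_0^\infty(U)$ be real-valued, and let $Z_f(\varphi)(s)=\int_{\mathbb{R}^2}|f(x,y)|^s\varphi(x,y)\,dx\,dy$, which is holomorphic on $\mathrm{Re}(s)>-1/b$. Then, with $\sigma$ real, the following hold. (i) If $p>1-a/b$, then $$\lim_{\sigma\to-1/b+0}(b\sigma+1)^{1-\frac{1-a/b}{p}}\,Z_f(\varphi)(\sigma)=4\hat C\,\varphi(0,0),\qquad \hat C=\frac{1}{q^{(1-a/b)/p}(1-a/b)}\,\Gamma\!\left(1-\frac{1-a/b}{p}\right).$$ (ii) If $p=1-a/b$, then $$\lim_{\sigma\to-1/b+0}|\log(b\sigma+1)|^{-1}\,Z_f(\varphi)(\sigma)=\frac{4}{pq}\,\varphi(0,0).$$ (iii) If $0<p<1-a/b$, then there exists a constant $C(\varphi)$, depending on $f,\varphi$ but independent of $\sigma$, such that $$\lim_{\sigma\to-1/b+0}Z_f(\varphi)(\sigma)=C(\varphi),$$ and $C(\varphi)$ is positive if $\varphi(0,0)>0$ and $\varphi\ge0$ on $U$.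
   Context: $\Gamma$ is the gamma function. $C_0^\infty(U)$ is the set of smooth functions with compact support contained in $U$. "Sufficiently small" means contained in some ball about the origin whose radius depends only on $f$. The notation $\sigma\to -1/b+0$ means that the real variable $\sigma$ tends to $-1/b$ from the right. *)

theory Defs
  imports "HOL-Complex_Analysis.Complex_Analysis"
begin

text \<open>\<open>k\<close>-fold differentiability on the whole space: the Frechet derivative exists everywhere and,
  for every direction \<open>v\<close>, the map \<open>x \<mapsto> f'(x) v\<close> is again \<open>k - 1\<close> times differentiable.\<close>

primrec times_differentiable :: "nat \<Rightarrow> ('a::real_normed_vector \<Rightarrow> 'b::real_normed_vector) \<Rightarrow> bool"
  where
    "times_differentiable 0 f \<longleftrightarrow> continuous_on UNIV f"
  | "times_differentiable (Suc k) f \<longleftrightarrow>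
       (\<forall>x. f differentiable (at x)) \<and>
       (\<forall>v. times_differentiable k (\<lambda>x. frechet_derivative f (at x) v))"

definition smooth :: "('a::real_normed_vector \<Rightarrow> 'b::real_normed_vector) \<Rightarrow> bool"
  where "smooth f \<longleftrightarrow> (\<forall>k. times_differentiable k f)"

definition test_functions :: "'a::real_normed_vector set \<Rightarrow> ('a \<Rightarrow> real) set"
  where "test_functions U =
    {\<phi>. smooth \<phi> \<and> compact (closure {z. \<phi> z \<noteq> 0}) \<and> closure {z. \<phi> z \<noteq> 0} \<subseteq> U}"

text \<open>The case distinction is needed: in HOL, \<open>- 1 / 0 = 0\<close>, so the bare formula would
  give \<open>1\<close> at \<open>0\<close>.\<close>

definition flat :: "real \<Rightarrow> real \<Rightarrow> real"
  where "flat p x = (if x = 0 then 0 else exp (- 1 / \<bar>x\<bar> powr p))"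

definition flat_perturbed_monomial ::
    "nat \<Rightarrow> nat \<Rightarrow> real \<Rightarrow> real \<Rightarrow> nat \<Rightarrow> nat \<Rightarrow> real \<times> real \<Rightarrow> real"
  where "flat_perturbed_monomial a b p p' q q' = (\<lambda>(x, y).
    x ^ a * y ^ b + x ^ a * y ^ (b - q) * flat p x + x ^ (a - q') * y ^ b * flat p' y)"

text \<open>In HOL, \<open>0 powr s = 0\<close> for every \<open>s\<close>, so the integrand vanishes on the zero set of \<open>f\<close>.
  This does not affect the integral when that set is a null set.\<close>

definition local_zeta ::
    "(real \<times> real \<Rightarrow> real) \<Rightarrow> (real \<times> real \<Rightarrow> real) \<Rightarrow> complex \<Rightarrow> complex"
  where "local_zeta f \<phi> s =
    (LINT z|lborel. complex_of_real \<bar>f z\<bar> powr s * complex_of_real (\<phi> z))"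

end

theory Submission
  imports Defs "HOL-Real_Asymp.Real_Asymp"
begin

text \<open>
  Off the axes \<open>\<bar>f\<bar> = \<bar>x\<bar>\<^sup>a \<bar>y\<bar>\<^sup>b (1 + (w(x) / \<bar>y\<bar>)\<^sup>q + e(y) / \<bar>x\<bar>\<^sup>q\<^sup>')\<close>, where \<open>e\<close> is flat
  and \<open>w(x) = exp (- 1 / (q \<bar>x\<bar>\<^sup>p))\<close>; the evenness of the two exponents makes the last factor at
  least \<open>1\<close>. So \<open>\<bar>f\<bar>\<^sup>\<sigma>\<close> behaves like the monomial \<open>\<bar>x\<bar>\<^sup>a\<^sup>\<sigma> \<bar>y\<bar>\<^sup>b\<^sup>\<sigma>\<close> as long as \<open>\<bar>y\<bar> \<ge> w(x)\<close>, while for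
  \<open>\<bar>y\<bar> < w(x)\<close> the first perturbation dominates and weakens the singularity at \<open>y = 0\<close> to an
  integrable one. The heart of the proof is that, uniformly in \<open>\<sigma> \<in> [-1/b, 0)\<close>, the difference between \<open>\<bar>f\<bar>\<^sup>\<sigma>\<close> and the monomial cut
  off at \<open>\<bar>y\<bar> \<ge> w(x)\<close> is dominated by a fixed integrable function
  (\<open>abs_F_powr_near_monomial\<close>, \<open>integrable_error_bound\<close>). Hence everything is decided by the cut-off
  monomial.

  Put \<open>\<delta> = b \<sigma> + 1\<close>, \<open>\<alpha> = a / b\<close>, \<open>\<gamma> = \<alpha> (1 - \<delta>)\<close>. Integrating the cut-off monomial in \<open>y\<close> gives
  \<open>2 (1 - w(x)\<^sup>\<delta>) / \<delta>\<close>, and \<open>1 - w(x)\<^sup>\<delta>\<close> is the integral of \<open>exp (- v)\<close> over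
  \<open>0 < v < \<delta> / (q \<bar>x\<bar>\<^sup>p)\<close>. Exchanging the order of integration makes the \<open>x\<close>-integral elementary, and
  the total mass becomes \<open>4 / (\<delta> (1 - \<gamma>))\<close> times the integral over \<open>v > 0\<close> of
  \<open>exp (- v) min 1 (\<delta> / (q v))\<close> raised to the power \<open>(1 - \<gamma>) / p\<close> on the minimum
  (\<open>nn_integral_flat_layer\<close>, \<open>has_bochner_integral_main_term\<close>). As \<open>\<delta> \<rightarrow> 0\<close> the exponent tends to
  \<open>\<kappa> = (1 - \<alpha>) / p\<close>. For \<open>\<kappa> < 1\<close> the integral is of order \<open>\<delta>\<^sup>\<kappa>\<close> with the constant
  \<open>\<Gamma>(1 - \<kappa>) / q\<^sup>\<kappa>\<close>; for \<open>\<kappa> = 1\<close> the range \<open>\<delta> / q < v < 1\<close> contributes the leading term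
  \<open>(\<delta> / q) \<bar>log \<delta>\<bar>\<close>. In both cases the normalising factor tends to \<open>0\<close>, and the cut-off monomial is
  bounded by an integrable function away from the origin, so the normalised measures concentrate at
  the origin and only \<open>\<phi>(0, 0)\<close> survives (\<open>normalized_zeta_limit\<close>).

  For \<open>\<kappa> > 1\<close> the cut-off monomial is integrable already at \<open>\<sigma> = -1/b\<close>, because its \<open>y\<close>-integral
  is \<open>2 / (q \<bar>x\<bar>\<^sup>p)\<close> and \<open>\<alpha> + p < 1\<close>. Then dominated convergence gives the limit, which is the integral
  of \<open>\<bar>f\<bar> powr (-1/b)\<close> against \<open>\<phi>\<close> and so inherits positivity.
\<close>

section \<open>Holomorphic dependence of the integral of a power on its exponent\<close>

text \<open>Differentiation under the integral sign. With \<open>3 \<eta>\<close> the distance of \<open>Re s\<close> from \<open>c\<close>, the difference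
  quotients of \<open>t \<mapsto> g\<^sup>t\<close> over the disc of radius \<open>\<eta>\<close> around \<open>s\<close> are dominated by
  \<open>(\<bar>g\<^sup>s\<^sup>+\<^sup>2\<^sup>\<eta>\<bar> + \<bar>g\<^sup>s\<^sup>-\<^sup>2\<^sup>\<eta>\<bar>) / \<eta>\<close>: one \<open>\<eta>\<close> pays for the logarithm produced by the derivative, the other
  for the displacement of \<open>t\<close>.\<close>

lemma holomorphic_on_integral_powr:
  fixes g :: "'a \<Rightarrow> real" and h :: "'a \<Rightarrow> complex"
  assumes g: "g \<in> borel_measurable M" "\<And>z. 0 \<le> g z"
    and int: "\<And>s. Re s > c \<Longrightarrow> integrable M (\<lambda>z. complex_of_real (g z) powr s * h z)"
  shows "(\<lambda>s. LINT z|M. complex_of_real (g z) powr s * h z) holomorphic_on {s. Re s > c}"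
proof -
  have "\<exists>D. ((\<lambda>s. LINT z|M. complex_of_real (g z) powr s * h z) has_field_derivative D) (at s)"
    if s: "Re s > c" for s
  proof -
    define \<eta> where "\<eta> = (Re s - c) / 3"
    have \<eta>: "0 < \<eta>" "c < Re s - 2 * \<eta>" "c < Re s + 2 * \<eta>" using s by (auto simp: \<eta>_def field_simps)
    define G where "G = (\<lambda>s z. complex_of_real (g z) powr s * h z)"
    define L where "L = (\<lambda>z. complex_of_real (ln (g z)))"
    have intG: "integrable M (G t)" if "Re t > c" for t using int[OF that] by (simp add: G_def)
    have G_pos: "G t z = exp (t * L z) * h z" if "g z \<noteq> 0" for t z
      using that g(2)[of z] by (simp add: G_def L_def powr_def Ln_of_real)
    have G_zero: "G t z = 0" if "g z = 0" for t z using that by (simp add: G_def)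
    define B where "B = (\<lambda>z. (norm (G (s + 2 * of_real \<eta>) z) + norm (G (s - 2 * of_real \<eta>) z)) / \<eta>)"
    have bound: "norm ((G t z - G s z) / (t - s)) \<le> B z"
      if t: "t \<in> ball s \<eta>" "t \<noteq> s" for t z
    proof (cases "g z = 0")
      case False
      define l k where "l = ln (g z)" and "k = t - s"
      have k: "norm k < \<eta>" "k \<noteq> 0" using t by (auto simp: k_def dist_norm norm_minus_commute)
      have Lz: "L z = of_real l" by (simp add: L_def l_def)
      have "(G t z - G s z) / (t - s) = exp (s * of_real l) * h z * ((exp (k * of_real l) - 1) / k)"
        using k False by (simp add: G_pos Lz k_def field_simps exp_diff exp_add)
      then have "norm ((G t z - G s z) / (t - s))
          = exp (Re s * l) * norm (h z) * (norm (exp (k * of_real l) - 1) / norm k)"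
        by (simp add: norm_mult norm_divide)
      also have "norm (exp (k * of_real l) - 1) / norm k \<le> exp \<bar>Re k * l\<bar> * \<bar>l\<bar>"
        using Taylor_exp[of "k * of_real l" 0] k(2)
        by (simp add: norm_mult field_simps)
      also have "\<dots> \<le> exp (\<eta> * \<bar>l\<bar>) * (exp (\<eta> * \<bar>l\<bar>) / \<eta>)"
      proof (intro mult_mono)
        have "\<bar>Re k\<bar> \<le> \<eta>" using abs_Re_le_cmod[of k] k by linarith
        then show "exp \<bar>Re k * l\<bar> \<le> exp (\<eta> * \<bar>l\<bar>)" by (simp add: abs_mult mult_right_mono)
        have "\<eta> * \<bar>l\<bar> \<le> exp (\<eta> * \<bar>l\<bar>)" using exp_ge_add_one_self[of "\<eta> * \<bar>l\<bar>"] by linarith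
        then show "\<bar>l\<bar> \<le> exp (\<eta> * \<bar>l\<bar>) / \<eta>" using \<eta> by (simp add: field_simps)
      qed (use \<eta> in auto)
      also have "\<dots> = exp (2 * \<eta> * \<bar>l\<bar>) / \<eta>"
        by (simp flip: exp_add)
      also have "\<dots> \<le> (exp (2 * \<eta> * l) + exp (- 2 * \<eta> * l)) / \<eta>"
        using \<eta> by (intro divide_right_mono) (auto simp: abs_if)
      finally have "norm ((G t z - G s z) / (t - s))
          \<le> exp (Re s * l) * norm (h z) * ((exp (2 * \<eta> * l) + exp (- 2 * \<eta> * l)) / \<eta>)"
        by (simp add: mult_left_mono)
      also have "\<dots> = B z"
      proof -
        have "norm (G (s + of_real r) z) = exp (Re s * l) * norm (h z) * exp (r * l)" for r
          using False by (simp add: G_pos Lz norm_mult distrib_right exp_add)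
        from this[of "2 * \<eta>"] this[of "- 2 * \<eta>"] show ?thesis
          by (simp add: B_def distrib_left)
      qed
      finally show ?thesis .
    qed (use \<eta> in \<open>simp add: G_zero B_def\<close>)
    have lim: "((\<lambda>t. (G t z - G s z) / (t - s)) \<longlongrightarrow> L z * G s z) (at s)" for z
    proof (cases "g z = 0")
      case False
      have "((\<lambda>t. G t z) has_field_derivative L z * G s z) (at s)"
        unfolding G_pos[OF False] by (auto intro!: derivative_eq_intros)
      then show ?thesis by (simp add: has_field_derivative_iff)
    qed (simp add: G_zero)
    have "((\<lambda>t. LINT z|M. G t z) has_field_derivative (LINT z|M. L z * G s z)) (at s within ball s \<eta>)"
      unfolding has_field_derivative_iff tendsto_at_iff_sequentially
    proof (intro allI impI)
      fix X assume X: "\<forall>i. X i \<in> ball s \<eta> - {s}" "X \<longlonglongrightarrow> s"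
      have Xc: "Re (X i) > c" for i
      proof -
        have "\<bar>Re (X i - s)\<bar> < \<eta>"
          using X(1)[rule_format, of i] abs_Re_le_cmod[of "X i - s"]
          by (simp add: dist_norm norm_minus_commute)
        then show ?thesis using \<eta> by simp
      qed
      have "(\<lambda>i. LINT z|M. (G (X i) z - G s z) / (X i - s)) \<longlonglongrightarrow> (LINT z|M. L z * G s z)"
      proof (rule integral_dominated_convergence[where w = B])
        show "(\<lambda>z. L z * G s z) \<in> borel_measurable M"
          using borel_measurable_integrable[OF intG[OF s]] g unfolding L_def by measurable
        show "(\<lambda>z. (G (X i) z - G s z) / (X i - s)) \<in> borel_measurable M" for i
          using intG[OF Xc] intG[OF s] by (intro borel_measurable_integrable) auto
        have "integrable M (G (s + 2 * of_real \<eta>))" "integrable M (G (s - 2 * of_real \<eta>))"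
          using \<eta> by (auto intro!: intG)
        then show "integrable M B" unfolding B_def by auto
        show "AE z in M. (\<lambda>i. (G (X i) z - G s z) / (X i - s)) \<longlonglongrightarrow> L z * G s z"
          using X lim by (auto simp: tendsto_at_iff_sequentially comp_def)
        show "AE z in M. norm ((G (X i) z - G s z) / (X i - s)) \<le> B z" for i
          using X bound by auto
      qed
      then show "((\<lambda>t. ((LINT z|M. G t z) - (LINT z|M. G s z)) / (t - s)) \<circ> X)
          \<longlonglongrightarrow> (LINT z|M. L z * G s z)"
        using intG[OF Xc] intG[OF s] by (simp add: comp_def Bochner_Integration.integral_diff)
    qed
    then show ?thesis
      using \<eta> by (subst (asm) at_within_open) (auto simp: G_def)
  qed
  then show ?thesis
    by (auto simp: holomorphic_on_def field_differentiable_def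
        intro: has_field_derivative_at_within)
qed

section \<open>Integrals of powers over the line and the plane\<close>

lemma nn_integral_lborel_pair:
  fixes f :: "real \<times> real \<Rightarrow> ennreal"
  assumes "f \<in> borel_measurable borel"
  shows "(\<integral>\<^sup>+z. f z \<partial>lborel) = (\<integral>\<^sup>+x. \<integral>\<^sup>+y. f (x, y) \<partial>lborel \<partial>lborel)"
  using assms lborel.nn_integral_fst[of f "lborel :: real measure"]
  by (simp add: lborel_prod)

lemma nn_integral_lborel_even:
  fixes f :: "real \<Rightarrow> ennreal"
  assumes f: "f \<in> borel_measurable borel" and even: "\<And>x. f (- x) = f x"
  shows "(\<integral>\<^sup>+x. f x \<partial>lborel) = 2 * (\<integral>\<^sup>+x\<in>{0<..}. f x \<partial>lborel)"
proof -
  have "(\<integral>\<^sup>+x. f x \<partial>lborel) = (\<integral>\<^sup>+x. f x * indicator {0<..} x + f x * indicator {..<0} x \<partial>lborel)"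
    by (intro nn_integral_cong_AE AE_I[where N = "{0}"]) (auto simp: indicator_def)
  also have "\<dots> = (\<integral>\<^sup>+x\<in>{0<..}. f x \<partial>lborel) + (\<integral>\<^sup>+x\<in>{..<0}. f x \<partial>lborel)"
    using f by (intro nn_integral_add) auto
  also have "(\<integral>\<^sup>+x\<in>{..<0}. f x \<partial>lborel) = (\<integral>\<^sup>+x\<in>{0<..}. f x \<partial>lborel)"
    using f by (subst nn_integral_real_affine[where c = "-1" and t = 0])
      (auto intro!: nn_integral_cong simp: even indicator_def)
  finally show ?thesis by (simp add: mult_2)
qed

lemma nn_integral_powr_from_0:
  assumes "s > -1" "c \<ge> 0"
  shows "(\<integral>\<^sup>+x\<in>{0..c}. ennreal (x powr s) \<partial>lborel) = ennreal (c powr (s + 1) / (s + 1))"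
  using nn_integral_has_integral_lebesgue[OF _ has_integral_powr_from_0[OF assms]]
  by (simp add: ennreal_mult'' ennreal_indicator mult.commute)

lemma nn_integral_powr_to_inf:
  assumes "s < -1" "c > 0"
  shows "(\<integral>\<^sup>+x\<in>{c..}. ennreal (x powr s) \<partial>lborel) = ennreal (- (c powr (s + 1)) / (s + 1))"
  using nn_integral_has_integral_lebesgue[OF _ has_integral_powr_to_inf[OF assms]]
  by (simp add: ennreal_mult'' ennreal_indicator mult.commute)

lemma nn_integral_abs_powr:
  assumes "s > -1" "c \<ge> 0"
  shows "(\<integral>\<^sup>+x\<in>{-c..c}. ennreal (\<bar>x\<bar> powr s) \<partial>lborel) = ennreal (2 * c powr (s + 1) / (s + 1))"
proof -
  have "(\<integral>\<^sup>+x\<in>{-c..c}. ennreal (\<bar>x\<bar> powr s) \<partial>lborel)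
      = 2 * (\<integral>\<^sup>+x\<in>{0<..}. ennreal (\<bar>x\<bar> powr s) * indicator {-c..c} x \<partial>lborel)"
    by (rule nn_integral_lborel_even) (auto simp: indicator_def)
  also have "(\<integral>\<^sup>+x\<in>{0<..}. ennreal (\<bar>x\<bar> powr s) * indicator {-c..c} x \<partial>lborel)
      = (\<integral>\<^sup>+x\<in>{0..c}. ennreal (x powr s) \<partial>lborel)"
    by (intro nn_integral_cong) (auto simp: indicator_def)
  finally show ?thesis
    using assms by (simp add: nn_integral_powr_from_0 ennreal_mult' mult_ac flip: times_divide_eq_right)
qed

lemma integrable_abs_powr:
  assumes "s > -1"
  shows "integrable lborel (\<lambda>x::real. indicator {-1..1} x * \<bar>x\<bar> powr s)"
proof (rule integrableI_nonneg)
  have "(\<integral>\<^sup>+x. ennreal (indicator {-1..1} x * \<bar>x\<bar> powr s) \<partial>lborel)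
      = (\<integral>\<^sup>+x\<in>{-1..1}. ennreal (\<bar>x\<bar> powr s) \<partial>lborel)"
    by (intro nn_integral_cong) (auto simp: indicator_def)
  also have "\<dots> < \<infinity>" using nn_integral_abs_powr[OF assms, of 1] by simp
  finally show "(\<integral>\<^sup>+x. ennreal (indicator {-1..1} x * \<bar>x\<bar> powr s) \<partial>lborel) < \<infinity>" .
qed auto

lemma integrable_lborel_pair_mult:
  fixes f g :: "real \<Rightarrow> real"
  assumes f: "integrable lborel f" and g: "integrable lborel g"
  shows "integrable lborel (\<lambda>z. f (fst z) * g (snd z))"
proof -
  have [measurable]: "f \<in> borel_measurable borel" "g \<in> borel_measurable borel"
    using f g by (auto dest: borel_measurable_integrable)
  have "integrable (lborel \<Otimes>\<^sub>M lborel) (\<lambda>z. f (fst z) * g (snd z))"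
    by (rule lborel_pair.Fubini_integrable)
       (use f g in \<open>auto simp: abs_mult intro!: integrable_mult_left\<close>)
  then show ?thesis by (simp add: lborel_prod)
qed

text \<open>The scale-invariant bump \<open>h(\<bar>y\<bar> / \<epsilon>) / \<bar>y\<bar>\<close> with \<open>h(t) = min (t\<^sup>\<theta>) (t\<^sup>-\<^sup>\<theta>)\<close>. It measures the error
  made near \<open>\<bar>y\<bar> = \<epsilon>\<close> when the perturbed monomial is replaced by its two asymptotic regimes, and its
  integral is bounded independently of \<open>\<epsilon>\<close>.\<close>

definition transition :: "real \<Rightarrow> real \<Rightarrow> real \<Rightarrow> real"
  where "transition \<theta> \<epsilon> y =
    (if \<bar>y\<bar> < \<epsilon> then (\<bar>y\<bar> / \<epsilon>) powr \<theta> else (\<epsilon> / \<bar>y\<bar>) powr \<theta>) / \<bar>y\<bar>"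

lemma measurable_transition [measurable]:
  assumes [measurable]: "f \<in> borel_measurable M" "g \<in> borel_measurable M"
  shows "(\<lambda>z. transition \<theta> (f z) (g z)) \<in> borel_measurable M"
  unfolding transition_def by measurable

lemma transition_nonneg: "0 \<le> transition \<theta> \<epsilon> y"
  by (simp add: transition_def)

lemma nn_integral_transition_le:
  assumes "\<theta> > 0" "\<epsilon> > 0"
  shows "(\<integral>\<^sup>+y. ennreal (transition \<theta> \<epsilon> y) \<partial>lborel) \<le> ennreal (4 / \<theta>)"
proof -
  have lin: "(\<integral>\<^sup>+y. c * f y + d * g y \<partial>lborel)
      = c * (\<integral>\<^sup>+y. f y \<partial>lborel) + d * (\<integral>\<^sup>+y. g y \<partial>lborel)"
    if "f \<in> borel_measurable lborel" "g \<in> borel_measurable lborel"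
    for c d :: ennreal and f g :: "real \<Rightarrow> ennreal"
    using that by (simp add: nn_integral_add nn_integral_cmult)
  have half: "(\<integral>\<^sup>+y. ennreal (transition \<theta> \<epsilon> y) \<partial>lborel)
      = 2 * (\<integral>\<^sup>+y\<in>{0<..}. ennreal (transition \<theta> \<epsilon> y) \<partial>lborel)"
    by (rule nn_integral_lborel_even) (auto simp: transition_def)
  have "(\<integral>\<^sup>+y\<in>{0<..}. ennreal (transition \<theta> \<epsilon> y) \<partial>lborel)
      \<le> (\<integral>\<^sup>+y. ennreal (\<epsilon> powr - \<theta>) * (ennreal (y powr (\<theta> - 1)) * indicator {0..\<epsilon>} y)
            + ennreal (\<epsilon> powr \<theta>) * (ennreal (y powr (- \<theta> - 1)) * indicator {\<epsilon>..} y) \<partial>lborel)"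
  proof (rule nn_integral_mono)
    fix y :: real
    have "transition \<theta> \<epsilon> y = \<epsilon> powr - \<theta> * y powr (\<theta> - 1)" if "0 < y" "y < \<epsilon>"
      using that by (simp add: transition_def powr_divide powr_diff powr_minus field_simps)
    moreover have "transition \<theta> \<epsilon> y = \<epsilon> powr \<theta> * y powr (- \<theta> - 1)" if "\<epsilon> \<le> y"
      using that assms by (simp add: transition_def powr_divide powr_diff powr_minus field_simps)
    ultimately show "ennreal (transition \<theta> \<epsilon> y) * indicator {0<..} y
      \<le> ennreal (\<epsilon> powr - \<theta>) * (ennreal (y powr (\<theta> - 1)) * indicator {0..\<epsilon>} y)
            + ennreal (\<epsilon> powr \<theta>) * (ennreal (y powr (- \<theta> - 1)) * indicator {\<epsilon>..} y)"
      using assms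
      by (cases "0 < y"; cases "y < \<epsilon>") (simp_all add: indicator_def add_increasing add_increasing2 flip: ennreal_mult')
  qed
  also have "\<dots> = ennreal (\<epsilon> powr - \<theta>) * (\<integral>\<^sup>+y\<in>{0..\<epsilon>}. ennreal (y powr (\<theta> - 1)) \<partial>lborel)
      + ennreal (\<epsilon> powr \<theta>) * (\<integral>\<^sup>+y\<in>{\<epsilon>..}. ennreal (y powr (- \<theta> - 1)) \<partial>lborel)"
    by (rule lin) auto
  also have "(\<integral>\<^sup>+y\<in>{0..\<epsilon>}. ennreal (y powr (\<theta> - 1)) \<partial>lborel) = ennreal (\<epsilon> powr \<theta> / \<theta>)"
    by (subst nn_integral_powr_from_0) (use assms in auto)
  also have "(\<integral>\<^sup>+y\<in>{\<epsilon>..}. ennreal (y powr (- \<theta> - 1)) \<partial>lborel) = ennreal (\<epsilon> powr - \<theta> / \<theta>)"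
    by (subst nn_integral_powr_to_inf) (use assms in auto)
  also have "ennreal (\<epsilon> powr - \<theta>) * ennreal (\<epsilon> powr \<theta> / \<theta>)
      + ennreal (\<epsilon> powr \<theta>) * ennreal (\<epsilon> powr - \<theta> / \<theta>)
      = ennreal (\<epsilon> powr - \<theta> * (\<epsilon> powr \<theta> / \<theta>) + \<epsilon> powr \<theta> * (\<epsilon> powr - \<theta> / \<theta>))"
    using assms by (simp flip: ennreal_mult ennreal_plus)
  also have "\<epsilon> powr - \<theta> * (\<epsilon> powr \<theta> / \<theta>) + \<epsilon> powr \<theta> * (\<epsilon> powr - \<theta> / \<theta>) = 2 / \<theta>"
    using assms by (simp add: powr_minus field_simps)
  finally have "(\<integral>\<^sup>+y. ennreal (transition \<theta> \<epsilon> y) \<partial>lborel) \<le> 2 * ennreal (2 / \<theta>)"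
    unfolding half by (simp add: mult_left_mono)
  also have "\<dots> = ennreal (4 / \<theta>)"
    using assms by (subst ennreal_numeral[symmetric], subst ennreal_mult[symmetric]) auto
  finally show ?thesis .
qed

definition square :: "(real \<times> real) set"
  where "square = {(x, y). \<bar>x\<bar> \<le> 1 \<and> \<bar>y\<bar> \<le> 1}"

lemma square_measurable [measurable]: "square \<in> sets borel"
proof -
  have "square = {-1..1} \<times> {-1..1}" by (auto simp: square_def)
  moreover have "closed ({-1..1} \<times> {-1..1} :: (real \<times> real) set)"
    by (intro closed_Times closed_atLeastAtMost)
  ultimately show ?thesis by (metis borel_closed)
qed

lemma two_mult_ennreal: "0 \<le> r \<Longrightarrow> 2 * ennreal r = ennreal (2 * r)"
  by (simp add: ennreal_mult)

lemma nn_integral_annulus: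
  fixes \<epsilon> \<delta> :: real
  assumes "0 < \<epsilon>" "\<epsilon> \<le> 1" "0 < \<delta>"
  shows "(\<integral>\<^sup>+y. ennreal (indicator {\<epsilon>..1} \<bar>y\<bar> * \<bar>y\<bar> powr (\<delta> - 1)) \<partial>lborel)
    = ennreal (2 * ((1 - \<epsilon> powr \<delta>) / \<delta>))"
proof -
  have "(\<integral>\<^sup>+y. ennreal (indicator {\<epsilon>..1} \<bar>y\<bar> * \<bar>y\<bar> powr (\<delta> - 1)) \<partial>lborel)
      = 2 * (\<integral>\<^sup>+y\<in>{0<..}. ennreal (indicator {\<epsilon>..1} \<bar>y\<bar> * \<bar>y\<bar> powr (\<delta> - 1)) \<partial>lborel)"
    by (rule nn_integral_lborel_even) auto
  also have "(\<integral>\<^sup>+y\<in>{0<..}. ennreal (indicator {\<epsilon>..1} \<bar>y\<bar> * \<bar>y\<bar> powr (\<delta> - 1)) \<partial>lborel)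
      = (\<integral>\<^sup>+y. ennreal (y powr (\<delta> - 1)) * indicator {\<epsilon>..1} y \<partial>lborel)"
    using assms by (intro nn_integral_cong) (auto simp: indicator_def)
  also have "\<dots> = ennreal (1 powr \<delta> / \<delta> - \<epsilon> powr \<delta> / \<delta>)"
    using assms by (intro nn_integral_FTC_Icc) (auto intro!: derivative_eq_intros)
  finally show ?thesis
    using assms powr_le1[of \<delta> \<epsilon>]
    by (simp add: two_mult_ennreal divide_right_mono flip: diff_divide_distrib)
qed

text \<open>The case \<open>\<delta> = 0\<close> of the preceding integral.\<close>

lemma nn_integral_annulus_log:
  fixes \<epsilon> :: real
  assumes "0 < \<epsilon>" "\<epsilon> \<le> 1"
  shows "(\<integral>\<^sup>+y. ennreal (indicator {\<epsilon>..1} \<bar>y\<bar> * \<bar>y\<bar> powr - 1) \<partial>lborel) = ennreal (2 * - ln \<epsilon>)"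
proof -
  have "(\<integral>\<^sup>+y. ennreal (indicator {\<epsilon>..1} \<bar>y\<bar> * \<bar>y\<bar> powr - 1) \<partial>lborel)
      = 2 * (\<integral>\<^sup>+y\<in>{0<..}. ennreal (indicator {\<epsilon>..1} \<bar>y\<bar> * \<bar>y\<bar> powr - 1) \<partial>lborel)"
    by (rule nn_integral_lborel_even) auto
  also have "(\<integral>\<^sup>+y\<in>{0<..}. ennreal (indicator {\<epsilon>..1} \<bar>y\<bar> * \<bar>y\<bar> powr - 1) \<partial>lborel)
      = (\<integral>\<^sup>+y. ennreal (1 / y) * indicator {\<epsilon>..1} y \<partial>lborel)"
    using assms by (intro nn_integral_cong) (auto simp: indicator_def powr_minus_divide)
  also have "\<dots> = ennreal (ln 1 - ln \<epsilon>)"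
    using assms by (intro nn_integral_FTC_Icc) (auto intro!: derivative_eq_intros)
  finally show ?thesis
    using assms by (simp add: two_mult_ennreal)
qed

section \<open>Integrals of layers of exponential width\<close>

lemma has_bochner_integral_Gamma:
  assumes "0 < x"
  shows "has_bochner_integral lborel
    (\<lambda>v::real. indicator {0<..} v * (exp (- v) * v powr (x - 1))) (Gamma x)"
proof (rule has_bochner_integral_nn_integral)
  have "(\<integral>\<^sup>+v. ennreal (indicator {0<..} v * (exp (- v) * v powr (x - 1))) \<partial>lborel)
      = (\<integral>\<^sup>+v. ennreal (indicator {0..} v * (v powr (x - 1) / exp v)) \<partial>lborel)"
    by (intro nn_integral_cong_AE AE_I[where N = "{0}"]) (auto simp: indicator_def exp_minus field_simps)
  also have "\<dots> = ennreal (Gamma x)"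
    using assms by (intro nn_integral_has_integral_lebesgue Gamma_integral_real) auto
  finally show "(\<integral>\<^sup>+v. ennreal (indicator {0<..} v * (exp (- v) * v powr (x - 1))) \<partial>lborel)
      = ennreal (Gamma x)" .
qed (use assms Gamma_real_pos in \<open>auto simp: less_imp_le\<close>)

text \<open>Up to elementary factors this is the mass of the cut-off monomial, with \<open>T\<close> proportional to
  \<open>\<delta>\<close>: what remains of the plane integral once the variable \<open>v\<close> that represents \<open>1 - w(x)\<^sup>\<delta>\<close> as an
  integral of \<open>exp (- v)\<close> is integrated last.\<close>

definition layer_integral :: "real \<Rightarrow> real \<Rightarrow> real"
  where "layer_integral \<kappa> T =
    (LINT v|lborel. indicator {0<..} v * (exp (- v) * min 1 (T / v) powr \<kappa>))"

lemma integrable_layer: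
  fixes \<kappa> T :: real
  assumes "0 \<le> \<kappa>" "0 < T"
  shows "integrable lborel (\<lambda>v. indicator {0<..} v * (exp (- v) * min 1 (T / v) powr \<kappa>))"
proof (rule Bochner_Integration.integrable_bound)
  show "integrable lborel (\<lambda>v::real. indicator {0<..} v * (exp (- v) * v powr (1 - 1)))"
    using has_bochner_integral_Gamma[of 1] by (auto simp: has_bochner_integral_iff)
  have "min 1 (T / v) powr \<kappa> \<le> 1" if "0 < v" for v
    using assms that by (intro powr_le1) auto
  then show "AE v in lborel. norm (indicator {0<..} v * (exp (- v) * min 1 (T / v) powr \<kappa>))
      \<le> norm (indicator {0<..} v * (exp (- v) * v powr (1 - 1)))"
    by (intro AE_I2) (auto simp: indicator_def abs_mult)
qed auto

text \<open>Write \<open>1 - exp (- T / x\<^sup>p)\<close> as the integral of \<open>exp (- v)\<close> over \<open>0 < v \<le> T / x\<^sup>p\<close> and integrate in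
  \<open>x\<close> first: for fixed \<open>v\<close> the admissible \<open>x\<close> form the interval up to \<open>min 1 (T / v)\<close> raised to
  \<open>1 / p\<close>, on which the power \<open>x\<^sup>-\<^sup>\<gamma>\<close> has an explicit integral.\<close>

lemma nn_integral_flat_layer:
  assumes \<gamma>: "\<gamma> < 1" and T: "0 < T" and p: "0 < p"
  shows "(\<integral>\<^sup>+x. ennreal (indicator {0<..1} x * (x powr - \<gamma> * (1 - exp (- T / x powr p)))) \<partial>lborel)
    = ennreal (layer_integral ((1 - \<gamma>) / p) T / (1 - \<gamma>))"
proof -
  define S where "S = {(x::real, v::real). 0 < x \<and> x \<le> 1 \<and> 0 < v \<and> v * x powr p \<le> T}"
  have S: "S \<in> sets (borel \<Otimes>\<^sub>M borel)"
  proof -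
    have "S = {z \<in> space (borel \<Otimes>\<^sub>M borel). 0 < fst z \<and> fst z \<le> 1 \<and> 0 < snd z \<and> snd z * fst z powr p \<le> T}"
      by (auto simp: S_def space_pair_measure)
    also have "\<dots> \<in> sets (borel \<Otimes>\<^sub>M borel)" by measurable
    finally show ?thesis .
  qed
  define k where "k = (\<lambda>(x, v). ennreal (indicator S (x, v) * (x powr - \<gamma> * exp (- v))))"
  have k: "k \<in> borel_measurable (lborel \<Otimes>\<^sub>M lborel)"
    using S unfolding k_def by measurable
  have inner_v: "(\<integral>\<^sup>+v. k (x, v) \<partial>lborel)
      = ennreal (indicator {0<..1} x * (x powr - \<gamma> * (1 - exp (- T / x powr p))))" for x
  proof (cases "0 < x \<and> x \<le> 1")
    case True
    have "(\<integral>\<^sup>+v. k (x, v) \<partial>lborel)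
        = (\<integral>\<^sup>+v. ennreal (x powr - \<gamma>) * (ennreal (exp (- v)) * indicator {0..T / x powr p} v) \<partial>lborel)"
      using True
      by (intro nn_integral_cong_AE AE_I[where N = "{0}"])
        (auto simp: k_def S_def indicator_def ennreal_mult' field_simps)
    also have "\<dots> = ennreal (x powr - \<gamma>)
        * (\<integral>\<^sup>+v. ennreal (exp (- v)) * indicator {0..T / x powr p} v \<partial>lborel)"
      by (intro nn_integral_cmult) auto
    also have "(\<integral>\<^sup>+v. ennreal (exp (- v)) * indicator {0..T / x powr p} v \<partial>lborel)
        = ennreal (- exp (- (T / x powr p)) - - exp (- 0))"
      using T by (intro nn_integral_FTC_Icc) (auto intro!: derivative_eq_intros)
    finally show ?thesis
      using True T by (simp flip: ennreal_mult)
  qed (auto simp: k_def S_def indicator_def)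
  have inner_x: "(\<integral>\<^sup>+x. k (x, v) \<partial>lborel)
      = ennreal (indicator {0<..} v * (exp (- v) * min 1 (T / v) powr ((1 - \<gamma>) / p)) / (1 - \<gamma>))" for v
  proof (cases "0 < v")
    case True
    define c where "c = min 1 (T / v) powr (1 / p)"
    have m: "0 < min 1 (T / v)" using True T by simp
    then have c: "0 < c" by (auto simp: c_def)
    have iff: "x \<le> 1 \<and> v * x powr p \<le> T \<longleftrightarrow> x \<le> c" if "0 < x" for x
    proof -
      have "x \<le> c \<longleftrightarrow> x powr p \<le> c powr p"
        using that p c by (metis less_eq_real_def linorder_not_less powr_less_mono2 powr_mono2)
      also have "c powr p = min 1 (T / v)"
        using True T p by (simp add: c_def powr_powr)
      also have "x powr p \<le> min 1 (T / v) \<longleftrightarrow> x powr p \<le> 1 powr p \<and> v * x powr p \<le> T"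
        using True by (simp add: field_simps)
      also have "x powr p \<le> 1 powr p \<longleftrightarrow> x \<le> 1"
        using that p by (metis less_eq_real_def linorder_not_less powr_less_mono2 powr_mono2 zero_le_one)
      finally show ?thesis by blast
    qed
    have "k (x, v) = ennreal (exp (- v)) * (ennreal (x powr - \<gamma>) * indicator {0..c} x)"
      if "x \<noteq> 0" for x
      using that True iff[of x]
      by (cases "0 < x"; cases "x \<le> c") (simp_all add: k_def S_def ennreal_mult' mult.commute)
    then have "(\<integral>\<^sup>+x. k (x, v) \<partial>lborel)
        = (\<integral>\<^sup>+x. ennreal (exp (- v)) * (ennreal (x powr - \<gamma>) * indicator {0..c} x) \<partial>lborel)"
      by (intro nn_integral_cong_AE AE_I[where N = "{0}"]) auto
    also have "\<dots> = ennreal (exp (- v)) * (\<integral>\<^sup>+x\<in>{0..c}. ennreal (x powr - \<gamma>) \<partial>lborel)"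
      by (intro nn_integral_cmult) auto
    also have "(\<integral>\<^sup>+x\<in>{0..c}. ennreal (x powr - \<gamma>) \<partial>lborel) = ennreal (c powr (- \<gamma> + 1) / (- \<gamma> + 1))"
      using \<gamma> c by (intro nn_integral_powr_from_0) auto
    also have "c powr (- \<gamma> + 1) = min 1 (T / v) powr ((1 - \<gamma>) / p)"
      by (simp add: c_def powr_powr)
    finally show ?thesis
      using True \<gamma> by (simp flip: ennreal_mult)
  qed (simp add: k_def S_def)
  have "(\<integral>\<^sup>+x. ennreal (indicator {0<..1} x * (x powr - \<gamma> * (1 - exp (- T / x powr p)))) \<partial>lborel)
      = (\<integral>\<^sup>+x. \<integral>\<^sup>+v. k (x, v) \<partial>lborel \<partial>lborel)"
    by (simp add: inner_v)
  also have "\<dots> = (\<integral>\<^sup>+v. \<integral>\<^sup>+x. k (x, v) \<partial>lborel \<partial>lborel)"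
    using lborel_pair.Fubini[OF k] by simp
  also have "\<dots> = ennreal (layer_integral ((1 - \<gamma>) / p) T / (1 - \<gamma>))"
    unfolding inner_x layer_integral_def
    using integrable_layer[of "(1 - \<gamma>) / p" T] \<gamma> T p
    by (subst nn_integral_eq_integral) auto
  finally show ?thesis .
qed

text \<open>Dominated convergence: \<open>T\<^sup>-\<^sup>\<kappa> min 1 (T / v)\<^sup>\<kappa>\<close> is at most \<open>v\<^sup>-\<^sup>\<kappa>\<close> and tends to it, and
  \<open>exp (- v) v\<^sup>-\<^sup>\<kappa>\<close> has integral \<open>\<Gamma>(1 - \<kappa>)\<close>. The drift \<open>c T\<close> of the exponent only lowers the integrand,
  since the base is at most \<open>1\<close>, and it disappears in the limit because \<open>T\<^sup>T \<rightarrow> 1\<close>.\<close>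

lemma layer_integral_power_asymptotics:
  assumes \<kappa>: "0 < \<kappa>" "\<kappa> < 1" and c: "0 \<le> c"
  shows "((\<lambda>T. T powr - \<kappa> * layer_integral (\<kappa> + c * T) T) \<longlongrightarrow> Gamma (1 - \<kappa>)) (at_right 0)"
proof (rule tendsto_at_right_sequentially[of 0 1])
  fix T :: "nat \<Rightarrow> real"
  assume T: "\<And>n. 0 < T n" "T \<longlonglongrightarrow> 0"
  have T_right: "filterlim T (at_right 0) sequentially"
    using T by (intro tendsto_imp_filterlim_at_right) auto
  have "(\<lambda>n. LINT v|lborel. T n powr - \<kappa> * (indicator {0<..} v * (exp (- v) * min 1 (T n / v) powr (\<kappa> + c * T n))))
      \<longlonglongrightarrow> (LINT v|lborel. indicator {0<..} v * (exp (- v) * v powr (1 - \<kappa> - 1)))"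
  proof (rule integral_dominated_convergence)
    show "integrable lborel (\<lambda>v. indicator {0<..} v * (exp (- v) * v powr (1 - \<kappa> - 1)))"
      using has_bochner_integral_Gamma[of "1 - \<kappa>"] \<kappa> by (auto simp: has_bochner_integral_iff)
    have lim: "(\<lambda>n. T n powr - \<kappa> * min 1 (T n / v) powr (\<kappa> + c * T n)) \<longlonglongrightarrow> v powr - \<kappa>"
      if v: "0 < v" for v
    proof -
      have "((\<lambda>t. (t / v) powr (c * t)) \<longlongrightarrow> 1) (at_right 0)"
        using v by real_asymp
      then have "(\<lambda>n. v powr - \<kappa> * (T n / v) powr (c * T n)) \<longlonglongrightarrow> v powr - \<kappa> * 1"
        by (intro tendsto_intros) (rule filterlim_compose[OF _ T_right])
      moreover have "\<forall>\<^sub>F n in sequentially. v powr - \<kappa> * (T n / v) powr (c * T n)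
          = T n powr - \<kappa> * min 1 (T n / v) powr (\<kappa> + c * T n)"
        using order_tendstoD(2)[OF T(2) v]
      proof eventually_elim
        case (elim n)
        then have "min 1 (T n / v) = T n / v" using v by simp
        show ?case
          unfolding \<open>min 1 (T n / v) = T n / v\<close> using T(1)[of n] v by (simp add: powr_add powr_divide powr_minus field_simps)
      qed
      ultimately show ?thesis by (auto elim: Lim_transform_eventually)
    qed
    show "AE v in lborel. (\<lambda>n. T n powr - \<kappa> * (indicator {0<..} v * (exp (- v) * min 1 (T n / v) powr (\<kappa> + c * T n))))
        \<longlonglongrightarrow> indicator {0<..} v * (exp (- v) * v powr (1 - \<kappa> - 1))"
    proof (rule AE_I2)
      fix v :: real
      show "(\<lambda>n. T n powr - \<kappa> * (indicator {0<..} v * (exp (- v) * min 1 (T n / v) powr (\<kappa> + c * T n))))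
        \<longlonglongrightarrow> indicator {0<..} v * (exp (- v) * v powr (1 - \<kappa> - 1))"
        using tendsto_mult[OF tendsto_const[of "exp (- v)"] lim[of v]]
        by (cases "0 < v") (simp_all add: mult_ac)
    qed
    show "AE v in lborel. norm (T n powr - \<kappa> * (indicator {0<..} v * (exp (- v) * min 1 (T n / v) powr (\<kappa> + c * T n))))
        \<le> indicator {0<..} v * (exp (- v) * v powr (1 - \<kappa> - 1))" for n
    proof (rule AE_I2)
      fix v :: real
      have "T n powr - \<kappa> * min 1 (T n / v) powr (\<kappa> + c * T n) \<le> v powr - \<kappa>" if v: "0 < v"
      proof -
        have "min 1 (T n / v) powr (\<kappa> + c * T n) \<le> min 1 (T n / v) powr \<kappa>"
          using T(1)[of n] v c by (intro powr_mono') auto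
        also have "\<dots> \<le> (T n / v) powr \<kappa>"
          using T(1)[of n] v \<kappa> by (intro powr_mono2) auto
        finally have "T n powr - \<kappa> * min 1 (T n / v) powr (\<kappa> + c * T n) \<le> T n powr - \<kappa> * (T n / v) powr \<kappa>"
          by (intro mult_left_mono) auto
        also have "\<dots> = v powr - \<kappa>"
          using T(1)[of n] v by (simp add: powr_divide powr_minus field_simps)
        finally show ?thesis .
      qed
      then show "norm (T n powr - \<kappa> * (indicator {0<..} v * (exp (- v) * min 1 (T n / v) powr (\<kappa> + c * T n))))
        \<le> indicator {0<..} v * (exp (- v) * v powr (1 - \<kappa> - 1))"
        by (cases "0 < v") (auto simp: abs_mult mult.left_commute[of _ "exp (- v)"])
    qed
  qed auto
  then show "(\<lambda>n. T n powr - \<kappa> * layer_integral (\<kappa> + c * T n) (T n)) \<longlonglongrightarrow> Gamma (1 - \<kappa>)"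
    using has_bochner_integral_Gamma[of "1 - \<kappa>"] \<kappa>
    by (simp add: layer_integral_def has_bochner_integral_iff)
qed simp

text \<open>The logarithm is the integral of \<open>1 / v\<close> over \<open>T \<le> v \<le> 1\<close>. The ranges \<open>v \<le> T\<close> and \<open>v \<ge> 1\<close>, as well as
  the replacement of \<open>exp (- v)\<close> by \<open>1\<close>, cost only \<open>O(T)\<close>; the drift \<open>c T\<close> of the exponent costs a
  factor between \<open>T powr (c T)\<close> and \<open>1\<close>.\<close>

lemma layer_integral_log_asymptotics:
  assumes c: "0 \<le> c"
  shows "((\<lambda>T. layer_integral (1 + c * T) T / (T * ln (1 / T))) \<longlongrightarrow> 1) (at_right 0)"
proof -
  have inv: "has_bochner_integral lborel (\<lambda>v. 1 / v * indicator {T..1} v) (ln (1 / T))"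
    if T: "0 < T" "T < 1" for T :: real
  proof -
    have "has_bochner_integral lborel (\<lambda>v. 1 / v * indicator {T..1} v) (ln 1 - ln T)"
      using T by (intro has_bochner_integral_FTC_Icc_nonneg)
        (auto intro!: derivative_eq_intros)
    then show ?thesis using T by (simp add: ln_div)
  qed
  have unit: "has_bochner_integral lborel (indicator {r..s} :: real \<Rightarrow> real) (s - r)" if "r \<le> s" for r s :: real
    using that by (auto simp: has_bochner_integral_iff)
  have upper: "layer_integral (1 + c * T) T \<le> T + (T * ln (1 / T) + T)" if T: "0 < T" "T < 1" for T
  proof -
    have gam: "has_bochner_integral lborel (\<lambda>v::real. T * (indicator {0<..} v * (exp (- v) * v powr (1 - 1)))) (T * 1)"
      using has_bochner_integral_Gamma[of 1] by (intro has_bochner_integral_mult_right) auto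
    have "layer_integral (1 + c * T) T
       \<le> (LINT v|lborel. indicator {0..T} v + (T * (1 / v * indicator {T..1} v)
            + T * (indicator {0<..} v * (exp (- v) * v powr (1 - 1)))))"
      unfolding layer_integral_def
    proof (rule integral_mono)
      show "integrable lborel (\<lambda>v. indicator {0<..} v * (exp (- v) * min 1 (T / v) powr (1 + c * T)))"
        using T c by (intro integrable_layer) auto
      show "integrable lborel (\<lambda>v. indicator {0..T} v + (T * (1 / v * indicator {T..1} v)
            + T * (indicator {0<..} v * (exp (- v) * v powr (1 - 1)))))"
        using unit[of 0 T] inv[OF T] gam T
        by (intro Bochner_Integration.integrable_add integrable_mult_right) (auto simp: has_bochner_integral_iff)
      fix v :: real
      show "indicator {0<..} v * (exp (- v) * min 1 (T / v) powr (1 + c * T))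
        \<le> indicator {0..T} v + (T * (1 / v * indicator {T..1} v)
            + T * (indicator {0<..} v * (exp (- v) * v powr (1 - 1))))"
      proof (cases "0 < v")
        case v: True
        have "min 1 (T / v) powr (1 + c * T) \<le> min 1 (T / v) powr 1"
          using T v c by (intro powr_mono') auto
        then have m: "min 1 (T / v) powr (1 + c * T) \<le> min 1 (T / v)"
          using T v by simp
        define R where "R = exp (- v) * min 1 (T / v) powr (1 + c * T)"
        have R: "R \<le> exp (- v) * min 1 (T / v)"
          using m by (simp add: R_def)
        also have "\<dots> \<le> 1 * min 1 (T / v)"
          using T v by (intro mult_right_mono) auto
        finally have R_min: "R \<le> 1" "R \<le> T / v" by auto
        have nonneg: "0 \<le> T * (1 / v * indicator {T..1} v)" "0 \<le> T * exp (- v)"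
          using T v by auto
        consider "v \<le> T" | "T < v" "v \<le> 1" | "1 < v" by linarith
        then have "R \<le> indicator {0..T} v + (T * (1 / v * indicator {T..1} v) + T * exp (- v))"
        proof cases
          case 1
          then have "indicator {0..T} v = (1 :: real)" using v by simp
          then show ?thesis using R_min(1) nonneg by linarith
        next
          case 2
          then have "T * (1 / v * indicator {T..1} v) = T / v" "indicator {0..T} v = (0 :: real)"
            by auto
          then show ?thesis using R_min(2) nonneg(2) by linarith
        next
          case 3
          have "exp (- v) * min 1 (T / v) \<le> exp (- v) * T"
            using 3 T by (intro mult_left_mono) (auto simp: min_le_iff_disj field_simps)
          then have "R \<le> T * exp (- v)"
            using order_trans[OF R] by (simp add: mult.commute)
          moreover have "0 \<le> (indicator {0..T} v :: real)" by simp
          ultimately show ?thesis using nonneg by linarith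
        qed
        then show ?thesis using v by (simp add: R_def)
      qed (use T in auto)
    qed
    also have "\<dots> = T + (T * ln (1 / T) + T * 1)"
      using has_bochner_integral_add[OF unit[of 0 T]
          has_bochner_integral_add[OF has_bochner_integral_mult_right[OF inv[OF T], of T] gam]] T
      by (intro has_bochner_integral_integral_eq) simp
    finally show ?thesis by simp
  qed
  have lower: "T powr (c * T) * (T * (ln (1 / T) - (1 - T))) \<le> layer_integral (1 + c * T) T"
    if T: "0 < T" "T < 1" for T
  proof -
    have "T powr (c * T) * (T * (ln (1 / T) - (1 - T)))
        = (LINT v|lborel. T powr (c * T) * (T * (1 / v * indicator {T..1} v - indicator {T..1} v)))"
      using unit[of T 1] inv[OF T] T
      by (intro has_bochner_integral_integral_eq[symmetric] has_bochner_integral_diff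
          has_bochner_integral_mult_right) auto
    also have "\<dots> \<le> layer_integral (1 + c * T) T"
      unfolding layer_integral_def
    proof (rule integral_mono)
      show "integrable lborel (\<lambda>v. indicator {0<..} v * (exp (- v) * min 1 (T / v) powr (1 + c * T)))"
        using T c by (intro integrable_layer) auto
      show "integrable lborel (\<lambda>v. T powr (c * T) * (T * (1 / v * indicator {T..1} v - indicator {T..1} v)))"
        using unit[of T 1] inv[OF T] T
        by (intro Bochner_Integration.integrable_diff integrable_mult_right) (auto simp: has_bochner_integral_iff)
      fix v :: real
      show "T powr (c * T) * (T * (1 / v * indicator {T..1} v - indicator {T..1} v))
        \<le> indicator {0<..} v * (exp (- v) * min 1 (T / v) powr (1 + c * T))"
      proof (cases "T \<le> v \<and> v \<le> 1")
        case True
        then have v: "0 < v" "T \<le> v" "v \<le> 1" using T by auto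
        have "T powr (c * T) * (T * (1 / v - 1)) = T powr (c * T) * ((1 - v) * (T / v))"
          using v by (simp add: field_simps)
        also have "\<dots> \<le> (T / v) powr (c * T) * (exp (- v) * (T / v))"
          using T v c exp_ge_add_one_self[of "- v"]
          by (intro mult_mono powr_mono2) (auto simp: field_simps)
        also have "\<dots> = exp (- v) * min 1 (T / v) powr (1 + c * T)"
          using T v by (simp add: min_def powr_add)
        finally show ?thesis using True v by simp
      qed (use T in \<open>auto simp: indicator_def\<close>)
    qed
    finally show ?thesis .
  qed
  have ev: "\<forall>\<^sub>F T::real in at_right 0. 0 < T \<and> T < 1"
    by (auto simp: eventually_at_right_field intro!: exI[of _ 1])
  show ?thesis
  proof (rule tendsto_sandwich)
    show "\<forall>\<^sub>F T in at_right 0. T powr (c * T) * (T * (ln (1 / T) - (1 - T))) / (T * ln (1 / T))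
        \<le> layer_integral (1 + c * T) T / (T * ln (1 / T))"
      using ev by eventually_elim (intro divide_right_mono lower; simp)
    show "\<forall>\<^sub>F T in at_right 0. layer_integral (1 + c * T) T / (T * ln (1 / T))
        \<le> (T + (T * ln (1 / T) + T)) / (T * ln (1 / T))"
      using ev by eventually_elim (intro divide_right_mono upper; simp)
    show "((\<lambda>T. T powr (c * T) * (T * (ln (1 / T) - (1 - T))) / (T * ln (1 / T))) \<longlongrightarrow> 1) (at_right 0)"
      by real_asymp
    show "((\<lambda>T::real. (T + (T * ln (1 / T) + T)) / (T * ln (1 / T))) \<longlongrightarrow> 1) (at_right 0)"
      by real_asymp
  qed
qed

section \<open>Test functions\<close>

lemma test_function_continuous:
  "\<phi> \<in> test_functions U \<Longrightarrow> continuous_on UNIV \<phi>"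
  unfolding test_functions_def smooth_def by (auto dest: spec[of _ 0])

lemma test_function_eq_0:
  "\<phi> \<in> test_functions U \<Longrightarrow> z \<notin> U \<Longrightarrow> \<phi> z = 0"
  using closure_subset[of "{z. \<phi> z \<noteq> 0}"] by (auto simp: test_functions_def)

lemma test_function_bounded:
  assumes "\<phi> \<in> test_functions U"
  obtains B where "0 \<le> B" "\<And>z. \<bar>\<phi> z\<bar> \<le> B"
proof -
  let ?K = "closure {z. \<phi> z \<noteq> 0}"
  have "compact (\<phi> ` ?K)"
    using assms test_function_continuous[OF assms]
    by (intro compact_continuous_image) (auto simp: test_functions_def intro: continuous_on_subset)
  then obtain B where B: "\<And>z. z \<in> ?K \<Longrightarrow> \<bar>\<phi> z\<bar> \<le> B"
    using compact_imp_bounded[of "\<phi> ` ?K"] by (auto simp: bounded_iff)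
  show ?thesis
  proof (rule that[of "max B 0"])
    fix z show "\<bar>\<phi> z\<bar> \<le> max B 0"
      using B[of z] closure_subset[of "{z. \<phi> z \<noteq> 0}"] by (cases "\<phi> z = 0") (auto simp: le_max_iff_disj)
  qed simp
qed

text \<open>The axes are negligible, so pointwise estimates are needed only off them.\<close>

lemma AE_lborel_pair_nonzero: "AE z in (lborel :: (real \<times> real) measure). fst z \<noteq> 0 \<and> snd z \<noteq> 0"
proof -
  have "AE z in (lborel \<Otimes>\<^sub>M lborel :: (real \<times> real) measure). fst z \<noteq> 0 \<and> snd z \<noteq> 0"
  proof (rule lborel_pair.AE_pair_measure)
    show "AE x in lborel. AE y in lborel. fst (x, y) \<noteq> (0::real) \<and> snd (x, y) \<noteq> (0::real)"
      using AE_lborel_singleton[of "0::real"] by (auto elim!: AE_mp)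
  qed measurable
  then show ?thesis unfolding lborel_prod .
qed

section \<open>Comparison with a cut-off monomial\<close>

text \<open>A flat function absorbs the pole \<open>1 / y\<close>; this is the inequality \<open>ln t \<le> t - 1\<close> at
  \<open>t = c p / y\<^sup>p\<close>.\<close>

lemma exp_minus_powr_bound:
  fixes c p :: real
  assumes "c > 0" "p > 0"
  obtains C where "\<And>y. y > 0 \<Longrightarrow> exp (- c / y powr p) / y \<le> C"
proof
  fix y :: real assume y: "y > 0"
  have "ln (c * p / y powr p) \<le> c * p / y powr p - 1"
    using assms y by (intro ln_le_minus_one) auto
  then have "- ln y \<le> c / y powr p + (- 1 - ln (c * p)) / p"
    using assms y by (simp add: ln_div ln_mult ln_powr field_simps)
  then have "exp (- c / y powr p - ln y) \<le> exp ((- 1 - ln (c * p)) / p)"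
    by simp
  then show "exp (- c / y powr p) / y \<le> exp ((- 1 - ln (c * p)) / p)"
    using y by (simp add: exp_diff)
qed

text \<open>The first power of \<open>u + v\<close> is enough because \<open>(1 + t)\<^sup>s \<ge> 1 / (1 + t) \<ge> 1 - t\<close>. A fractional power
  of \<open>v\<close> is admissible because the left-hand side never exceeds \<open>1\<close> and \<open>min 1 v \<le> v\<^sup>\<theta>\<close>.\<close>

lemma one_minus_powr_le:
  fixes u v s \<theta> :: real
  assumes "0 \<le> u" "0 \<le> v" "- 1 \<le> s" "0 \<le> \<theta>" "\<theta> \<le> 1"
  shows "1 - (1 + u + v) powr s \<le> u + v powr \<theta>"
proof (cases "v \<le> 1")
  case True
  have "1 - (u + v) \<le> 1 / (1 + u + v)"
    using assms by (simp add: field_simps)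
  also have "\<dots> = (1 + u + v) powr - 1"
    using assms by (simp add: powr_minus field_simps)
  also have "\<dots> \<le> (1 + u + v) powr s"
    using assms by (intro powr_mono) auto
  finally show ?thesis
    using powr_mono'[of \<theta> 1 v] True assms by simp
next
  case False
  then have "1 \<le> v powr \<theta>" using assms by (simp add: ge_one_powr_ge_zero)
  moreover have "0 \<le> (1 + u + v) powr s" by simp
  ultimately show ?thesis using assms by linarith
qed

locale flat_perturbation =
  fixes a b q q' :: nat and p p' :: real
  assumes a: "2 \<le> a" and ab: "a < b" and p: "0 < p" and p': "0 < p'"
    and even_q: "even q" and q: "2 \<le> q" "q \<le> b"
    and even_q': "even q'" and q': "2 \<le> q'" "q' \<le> a"
begin

abbreviation F :: "real \<times> real \<Rightarrow> real"
  where "F \<equiv> flat_perturbed_monomial a b p p' q q'"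

definition \<alpha> :: real where "\<alpha> = real a / real b"

text \<open>The modulus of \<open>y\<close> at which the monomial and its first perturbation balance: the \<open>q\<close>-th root of
  \<open>flat p x\<close>. At \<open>x = 0\<close> it takes the value \<open>1\<close>, which only concerns a null set and keeps it positive.\<close>

definition width :: "real \<Rightarrow> real" where "width x = exp (- 1 / (real q * \<bar>x\<bar> powr p))"

definition main_zone :: "(real \<times> real) set"
  where "main_zone = {(x, y). \<bar>x\<bar> \<le> 1 \<and> \<bar>y\<bar> \<le> 1 \<and> width x \<le> \<bar>y\<bar>}"

text \<open>The monomial raised to the power \<open>\<sigma>\<close>, cut off where the first perturbation takes over.\<close>

definition main_term :: "real \<Rightarrow> real \<times> real \<Rightarrow> real"
  where "main_term \<sigma> = (\<lambda>(x, y).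
    indicator main_zone (x, y) * (\<bar>x\<bar> powr (real a * \<sigma>) * \<bar>y\<bar> powr (real b * \<sigma>)))"

text \<open>The first summand accounts for the perturbation in \<open>x\<close>, on both sides of \<open>\<bar>y\<bar> = width x\<close>; the second
  one for the perturbation in \<open>y\<close>. Any exponent strictly between \<open>\<alpha>\<close> and \<open>1\<close> would serve in the second
  summand; \<open>(1 + \<alpha>) / 2\<close> is the midpoint.\<close>

definition error_bound :: "real \<Rightarrow> real \<times> real \<Rightarrow> real"
  where "error_bound C = (\<lambda>(x, y).
    \<bar>x\<bar> powr - \<alpha> * transition (real q / real b) (width x) y
    + C * \<bar>x\<bar> powr - ((1 + \<alpha>) / 2))"

lemma \<alpha>: "0 < \<alpha>" "\<alpha> < 1"
  using a ab by (auto simp: \<alpha>_def)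

lemma b_pos: "0 < real b" using ab by simp

lemma width: "0 < width x" "width x \<le> 1"
  by (auto simp: width_def)

lemma flat_eq_width: "x \<noteq> 0 \<Longrightarrow> flat p x = width x ^ q"
  using q by (simp add: flat_def width_def flip: exp_of_nat_mult)

lemma F_measurable [measurable]: "F \<in> borel_measurable borel"
proof -
  have [measurable]: "flat r \<in> borel_measurable borel" for r
    unfolding flat_def by measurable
  show ?thesis
    unfolding flat_perturbed_monomial_def borel_prod[symmetric] by measurable
qed

lemma width_measurable [measurable]: "width \<in> borel_measurable borel"
  unfolding width_def by measurable

lemma main_zone_measurable [measurable]: "main_zone \<in> sets borel"
proof -
  have "main_zone = {z \<in> space (borel \<Otimes>\<^sub>M borel). \<bar>fst z\<bar> \<le> 1 \<and> \<bar>snd z\<bar> \<le> 1 \<and> width (fst z) \<le> \<bar>snd z\<bar>}"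
    by (auto simp: main_zone_def space_pair_measure)
  also have "\<dots> \<in> sets (borel \<Otimes>\<^sub>M borel)" by measurable
  finally show ?thesis unfolding borel_prod[symmetric] .
qed

lemma main_term_measurable [measurable]: "main_term \<sigma> \<in> borel_measurable borel"
  using main_zone_measurable unfolding main_term_def borel_prod[symmetric] by measurable

text \<open>Since \<open>q\<close> and \<open>q'\<close> are even, dividing by \<open>y\<^sup>q\<close> or \<open>x\<^sup>q\<^sup>'\<close> does not change signs: on each quadrant the
  three terms of \<open>F\<close> have the same sign and cannot cancel.\<close>

lemma abs_F:
  assumes "x \<noteq> 0" "y \<noteq> 0"
  shows "\<bar>F (x, y)\<bar> = \<bar>x\<bar> ^ a * \<bar>y\<bar> ^ b * (1 + (width x / \<bar>y\<bar>) ^ q + flat p' y / \<bar>x\<bar> ^ q')"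
proof -
  have "y ^ (b - q) = y ^ b / \<bar>y\<bar> ^ q" "x ^ (a - q') = x ^ a / \<bar>x\<bar> ^ q'"
    using assms q q' even_q even_q' by (auto simp: power_diff power_even_abs)
  then have "F (x, y) = x ^ a * y ^ b * (1 + (width x / \<bar>y\<bar>) ^ q + flat p' y / \<bar>x\<bar> ^ q')"
    using assms by (simp add: flat_perturbed_monomial_def flat_eq_width power_divide algebra_simps)
  moreover have "0 \<le> 1 + (width x / \<bar>y\<bar>) ^ q + flat p' y / \<bar>x\<bar> ^ q'"
    using width[of x] by (auto simp: flat_def intro!: add_nonneg_nonneg divide_nonneg_nonneg)
  ultimately show ?thesis by (simp add: abs_mult power_abs)
qed

lemma monomial_powr:
  assumes "0 < x" "0 < y"
  shows "(x ^ a * y ^ b) powr s = x powr (real a * s) * y powr (real b * s)"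
  using assms by (simp add: powr_mult powr_powr flip: powr_realpow)

lemma abs_F_ge:
  assumes "x \<noteq> 0" "y \<noteq> 0"
  shows "\<bar>x\<bar> ^ a * \<bar>y\<bar> ^ b \<le> \<bar>F (x, y)\<bar>"
    and "\<bar>x\<bar> ^ a * \<bar>y\<bar> ^ b * (width x / \<bar>y\<bar>) ^ q \<le> \<bar>F (x, y)\<bar>"
proof -
  have "0 \<le> (width x / \<bar>y\<bar>) ^ q" "0 \<le> flat p' y / \<bar>x\<bar> ^ q'"
    using width[of x] by (auto simp: flat_def)
  then have "\<bar>x\<bar> ^ a * \<bar>y\<bar> ^ b * t \<le> \<bar>F (x, y)\<bar>" if "t \<in> {1, (width x / \<bar>y\<bar>) ^ q}" for t
    unfolding abs_F[OF assms] using that by (intro mult_left_mono) auto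
  from this[of 1] this[of "(width x / \<bar>y\<bar>) ^ q"]
  show "\<bar>x\<bar> ^ a * \<bar>y\<bar> ^ b \<le> \<bar>F (x, y)\<bar>"
    "\<bar>x\<bar> ^ a * \<bar>y\<bar> ^ b * (width x / \<bar>y\<bar>) ^ q \<le> \<bar>F (x, y)\<bar>"
    by simp_all
qed

text \<open>Here \<open>\<bar>F\<bar>\<close> is at least the first perturbation, which is at most \<open>1\<close> on the square; so its negative
  power is largest at the end point \<open>\<sigma> = -1/b\<close>. The factor \<open>(\<bar>y\<bar> / width x) powr (q/b)\<close> gained over the
  monomial makes the bound integrable at \<open>y = 0\<close>.\<close>

lemma F_powr_le_below_width:
  assumes "0 < \<bar>x\<bar>" "\<bar>x\<bar> \<le> 1" "0 < \<bar>y\<bar>" "\<bar>y\<bar> < width x" and \<sigma>: "- 1 / real b \<le> \<sigma>" "\<sigma> < 0"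
  shows "\<bar>F (x, y)\<bar> powr \<sigma> \<le> \<bar>x\<bar> powr - \<alpha> * transition (real q / real b) (width x) y"
proof -
  define X Y E where "X = \<bar>x\<bar>" and "Y = \<bar>y\<bar>" and "E = width x"
  have X: "0 < X" "X \<le> 1" and Y: "0 < Y" "Y < E" and E: "0 < E" "E \<le> 1"
    using assms width[of x] by (auto simp: X_def Y_def E_def)
  define G where "G = X ^ a * Y ^ b * (E / Y) ^ q"
  have G0: "0 < G" using X Y E by (simp add: G_def)
  have "Y ^ b = Y ^ (b - q) * Y ^ q"
    using q by (simp flip: power_add)
  then have "G = X ^ a * (Y ^ (b - q) * E ^ q)"
    using Y by (simp add: G_def power_divide)
  also have "\<dots> \<le> 1"
    using X Y E by (intro mult_le_one power_le_one) auto
  finally have G1: "G \<le> 1" .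
  have "\<bar>F (x, y)\<bar> powr \<sigma> \<le> G powr \<sigma>"
    using abs_F_ge(2)[of x y] assms G0 by (intro powr_mono2') (auto simp: G_def X_def Y_def E_def)
  also have "\<dots> \<le> G powr (- 1 / real b)"
    using G0 G1 \<sigma> by (intro powr_mono') auto
  also have "\<dots> = X powr (real a * (- 1 / real b)) * Y powr (real b * (- 1 / real b))
      * (E / Y) powr (real q * (- 1 / real b))"
  proof -
    have "((E / Y) ^ q) powr s = (E / Y) powr (real q * s)" for s
      using Y E by (simp add: powr_powr flip: powr_realpow)
    then show ?thesis
      unfolding G_def using X Y E by (simp add: powr_mult[of "X ^ a * Y ^ b"] monomial_powr)
  qed
  also have "\<dots> = X powr - \<alpha> * ((Y / E) powr (real q / real b) / Y)"
    using X Y E b_pos by (simp add: \<alpha>_def powr_minus powr_divide field_simps)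
  finally show ?thesis
    using Y by (simp add: transition_def X_def Y_def E_def)
qed

text \<open>Above the width, \<open>\<bar>F\<bar>\<^sup>\<sigma>\<close> is the monomial power times \<open>(1 + w + v)\<^sup>\<sigma>\<close>, so the error is at most the monomial
  power at \<open>-1/b\<close> times \<open>w + v\<^sup>\<theta>\<close>. The term \<open>w\<close> decays away from \<open>\<bar>y\<bar> = width x\<close>. In \<open>v = flat p' y / \<bar>x\<bar>\<^sup>q\<^sup>'\<close>
  a small power \<open>\<theta>\<close> is used: it costs only a slightly worse singularity in \<open>x\<close>, still integrable since
  \<open>\<alpha> < 1\<close>, whereas any positive power of the flat factor removes the pole \<open>1 / \<bar>y\<bar>\<close>. The bound does not depend on
  \<open>\<sigma>\<close>.\<close>

lemma abs_F_powr_near_monomial: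
  obtains C where "C \<ge> 0"
    "\<And>x y \<sigma>. \<lbrakk>0 < \<bar>x\<bar>; \<bar>x\<bar> \<le> 1; 0 < \<bar>y\<bar>; \<bar>y\<bar> \<le> 1; - 1 / real b \<le> \<sigma>; \<sigma> < 0\<rbrakk>
       \<Longrightarrow> \<bar>\<bar>F (x, y)\<bar> powr \<sigma> - main_term \<sigma> (x, y)\<bar> \<le> error_bound C (x, y)"
proof -
  \<comment> \<open>\<open>\<theta>\<close> is chosen so that \<open>q' \<theta>\<close> is the distance from \<open>\<alpha>\<close> to \<open>(1 + \<alpha>) / 2\<close>.\<close>
  define \<theta> where "\<theta> = (1 - \<alpha>) / 2 / real q'"
  have \<theta>: "0 < \<theta>" "\<theta> \<le> 1" "real q' * \<theta> = (1 - \<alpha>) / 2"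
    using \<alpha> q' by (auto simp: \<theta>_def field_simps)
  obtain C where C: "\<And>y. y > 0 \<Longrightarrow> exp (- \<theta> / y powr p') / y \<le> C"
    using exp_minus_powr_bound[OF \<theta>(1) p'] by blast
  have C0: "C \<ge> 0"
    using C[of 1] by (simp add: order_trans[of 0 "exp (- \<theta>)"])
  show ?thesis
  proof (rule that[OF C0])
    fix x y \<sigma> :: real
    assume x: "0 < \<bar>x\<bar>" "\<bar>x\<bar> \<le> 1" and y: "0 < \<bar>y\<bar>" "\<bar>y\<bar> \<le> 1" and \<sigma>: "- 1 / real b \<le> \<sigma>" "\<sigma> < 0"
    define X Y E where "X = \<bar>x\<bar>" and "Y = \<bar>y\<bar>" and "E = width x"
    have X: "0 < X" "X \<le> 1" and Y: "0 < Y" "Y \<le> 1" and E: "0 < E" "E \<le> 1"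
      using x y width[of x] by (auto simp: X_def Y_def E_def)
    have err0: "0 \<le> C * X powr - ((1 + \<alpha>) / 2)" using C0 by simp
    show "\<bar>\<bar>F (x, y)\<bar> powr \<sigma> - main_term \<sigma> (x, y)\<bar> \<le> error_bound C (x, y)"
    proof (cases "Y < E")
      case True
      then have "main_term \<sigma> (x, y) = 0"
        by (simp add: main_term_def main_zone_def Y_def E_def)
      then show ?thesis
        using F_powr_le_below_width[of x y \<sigma>] True x y \<sigma> err0
        by (simp add: error_bound_def Y_def E_def X_def)
    next
      case False
      define P w v where "P = X ^ a * Y ^ b" and "w = (E / Y) ^ q" and "v = flat p' y / X ^ q'"
      have P: "0 < P" "P \<le> 1" using X Y by (auto simp: P_def intro!: mult_le_one power_le_one)
      have wv: "0 \<le> w" "0 \<le> v" using X Y E by (auto simp: w_def v_def flat_def)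
      have F: "\<bar>F (x, y)\<bar> = P * (1 + w + v)"
        using x y by (simp add: abs_F P_def w_def v_def X_def Y_def E_def)
      have "main_term \<sigma> (x, y) = P powr \<sigma>"
        using False x y monomial_powr[of X Y \<sigma>] X Y
        by (simp add: main_term_def main_zone_def P_def X_def Y_def E_def)
      then have "\<bar>\<bar>F (x, y)\<bar> powr \<sigma> - main_term \<sigma> (x, y)\<bar> = \<bar>P powr \<sigma> * ((1 + w + v) powr \<sigma> - 1)\<bar>"
        using P wv by (simp add: F powr_mult right_diff_distrib)
      also have "\<dots> = P powr \<sigma> * (1 - (1 + w + v) powr \<sigma>)"
        using powr_mono[of \<sigma> 0 "1 + w + v"] wv \<sigma> by (simp add: abs_mult)
      also have "\<dots> \<le> P powr (- 1 / real b) * (w + v powr \<theta>)"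
      proof (intro mult_mono)
        show "P powr \<sigma> \<le> P powr (- 1 / real b)"
          using P \<sigma> by (intro powr_mono') auto
        have "- 1 \<le> - 1 / real b" using ab by simp
        then have "- 1 \<le> \<sigma>" using \<sigma> by linarith
        then show "1 - (1 + w + v) powr \<sigma> \<le> w + v powr \<theta>"
          using wv \<theta> by (intro one_minus_powr_le) auto
        show "0 \<le> 1 - (1 + w + v) powr \<sigma>"
          using powr_mono[of \<sigma> 0 "1 + w + v"] wv \<sigma> by simp
      qed auto
      also have "P powr (- 1 / real b) = X powr - \<alpha> * (1 / Y)"
        unfolding P_def using monomial_powr[of X Y "- 1 / real b"] X Y b_pos
        by (simp add: \<alpha>_def powr_minus_divide)
      also have "X powr - \<alpha> * (1 / Y) * (w + v powr \<theta>)
          = X powr - \<alpha> * (w / Y) + X powr - \<alpha> * (v powr \<theta> / Y)"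
        by (simp add: algebra_simps add_divide_distrib)
      also have "\<dots> \<le> X powr - \<alpha> * transition (real q / real b) E y + C * X powr - ((1 + \<alpha>) / 2)"
      proof (rule add_mono)
        have "w = (E / Y) powr real q"
          using Y E by (simp add: w_def powr_realpow)
        also have "\<dots> \<le> (E / Y) powr (real q / real b)"
          using False Y E q b_pos by (intro powr_mono') (auto simp: field_simps)
        finally show "X powr - \<alpha> * (w / Y) \<le> X powr - \<alpha> * transition (real q / real b) E y"
          using False Y by (intro mult_left_mono) (auto simp: transition_def Y_def divide_right_mono)
        have "v powr \<theta> / Y = exp (- \<theta> / Y powr p') / Y * X powr - ((1 - \<alpha>) / 2)"
          using X Y y
          by (simp add: \<theta>(3) v_def flat_def Y_def powr_divide powr_powr powr_minus_divide exp_powr_real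
              flip: powr_realpow)
        also have "\<dots> \<le> C * X powr - ((1 - \<alpha>) / 2)"
          using C[OF Y(1)] by (intro mult_right_mono) auto
        finally have "X powr - \<alpha> * (v powr \<theta> / Y) \<le> X powr - \<alpha> * (C * X powr - ((1 - \<alpha>) / 2))"
          by (intro mult_left_mono) auto
        also have "\<dots> = C * X powr (- \<alpha> - (1 - \<alpha>) / 2)"
          using X by (simp add: powr_diff powr_minus_divide)
        also have "- \<alpha> - (1 - \<alpha>) / 2 = - ((1 + \<alpha>) / 2)"
          by (simp add: field_simps)
        finally show "X powr - \<alpha> * (v powr \<theta> / Y) \<le> C * X powr - ((1 + \<alpha>) / 2)" .
      qed
      finally show ?thesis
        by (simp add: error_bound_def X_def E_def)
    qed
  qed
qed

section \<open>Integrability and total mass of the cut-off monomial\<close>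

lemma main_term_eq:
  "main_term \<sigma> (x, y) = (indicator {-1..1} x * \<bar>x\<bar> powr (real a * \<sigma>))
     * (indicator {width x..1} \<bar>y\<bar> * \<bar>y\<bar> powr (real b * \<sigma>))"
  by (auto simp: main_term_def main_zone_def indicator_def)

lemma main_term_nonneg: "0 \<le> main_term \<sigma> z"
  by (cases z) (simp add: main_term_def)

lemma nn_integral_main_term_iterated:
  "(\<integral>\<^sup>+z. ennreal (main_term \<sigma> z) \<partial>lborel)
   = (\<integral>\<^sup>+x. ennreal (indicator {-1..1} x * \<bar>x\<bar> powr (real a * \<sigma>))
        * (\<integral>\<^sup>+y. ennreal (indicator {width x..1} \<bar>y\<bar> * \<bar>y\<bar> powr (real b * \<sigma>)) \<partial>lborel) \<partial>lborel)"
proof -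
  have "(\<integral>\<^sup>+z. ennreal (main_term \<sigma> z) \<partial>lborel)
      = (\<integral>\<^sup>+x. \<integral>\<^sup>+y. ennreal (main_term \<sigma> (x, y)) \<partial>lborel \<partial>lborel)"
    by (rule nn_integral_lborel_pair) simp
  also have "\<dots> = (\<integral>\<^sup>+x. ennreal (indicator {-1..1} x * \<bar>x\<bar> powr (real a * \<sigma>))
        * (\<integral>\<^sup>+y. ennreal (indicator {width x..1} \<bar>y\<bar> * \<bar>y\<bar> powr (real b * \<sigma>)) \<partial>lborel) \<partial>lborel)"
    unfolding main_term_eq
    by (intro nn_integral_cong, subst nn_integral_cmult[symmetric]) (auto simp: ennreal_mult')
  finally show ?thesis .
qed

text \<open>The integral of the main term for \<open>\<sigma> = (\<delta> - 1) / b\<close>.\<close>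

definition mass :: "real \<Rightarrow> real"
  where "mass \<delta> = 4 / (\<delta> * (1 - \<alpha> * (1 - \<delta>)))
    * layer_integral ((1 - \<alpha> * (1 - \<delta>)) / p) (\<delta> / real q)"

lemma exponent_less_1: "0 < \<delta> \<Longrightarrow> \<alpha> * (1 - \<delta>) < 1"
  using \<alpha>(2) mult_pos_pos[OF \<alpha>(1), of \<delta>] unfolding right_diff_distrib by linarith

lemma has_bochner_integral_main_term:
  assumes \<delta>: "0 < \<delta>"
  shows "has_bochner_integral lborel (main_term ((\<delta> - 1) / real b)) (mass \<delta>)"
proof (rule has_bochner_integral_nn_integral)
  define \<gamma> where "\<gamma> = \<alpha> * (1 - \<delta>)"
  have \<gamma>: "\<gamma> < 1" using exponent_less_1[OF \<delta>] by (simp add: \<gamma>_def)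
  have q0: "0 < real q" using q by simp
  have ex: "real a * ((\<delta> - 1) / real b) = - \<gamma>" "real b * ((\<delta> - 1) / real b) = \<delta> - 1"
    using b_pos by (auto simp: \<gamma>_def \<alpha>_def field_simps)
  have layer0: "0 \<le> layer_integral \<kappa> T" for \<kappa> T
    unfolding layer_integral_def by (intro integral_nonneg_AE) auto
  have width_powr: "width x powr \<delta> = exp (- (\<delta> / real q) / \<bar>x\<bar> powr p)" for x
    by (simp add: width_def exp_powr_real)
  have width_powr_le: "width x powr \<delta> \<le> 1" for x
    using width[of x] \<delta> by (intro powr_le1) auto
  have "(\<integral>\<^sup>+z. ennreal (main_term ((\<delta> - 1) / real b) z) \<partial>lborel)
      = (\<integral>\<^sup>+x. ennreal (indicator {-1..1} x * \<bar>x\<bar> powr - \<gamma>) * ennreal (2 * ((1 - width x powr \<delta>) / \<delta>)) \<partial>lborel)"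
    unfolding nn_integral_main_term_iterated ex using width \<delta>
    by (simp add: nn_integral_annulus)
  also have "\<dots> = 2 * (\<integral>\<^sup>+x\<in>{0<..}. ennreal (indicator {-1..1} x * \<bar>x\<bar> powr - \<gamma>)
        * ennreal (2 * ((1 - width x powr \<delta>) / \<delta>)) \<partial>lborel)"
    by (rule nn_integral_lborel_even) (auto simp: width_def indicator_def)
  also have "(\<integral>\<^sup>+x\<in>{0<..}. ennreal (indicator {-1..1} x * \<bar>x\<bar> powr - \<gamma>)
        * ennreal (2 * ((1 - width x powr \<delta>) / \<delta>)) \<partial>lborel)
      = (\<integral>\<^sup>+x. ennreal (2 / \<delta>) * ennreal (indicator {0<..1} x * (x powr - \<gamma> * (1 - exp (- (\<delta> / real q) / x powr p)))) \<partial>lborel)"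
  proof (rule nn_integral_cong)
    fix x :: real
    show "ennreal (indicator {-1..1} x * \<bar>x\<bar> powr - \<gamma>) * ennreal (2 * ((1 - width x powr \<delta>) / \<delta>)) * indicator {0<..} x
      = ennreal (2 / \<delta>) * ennreal (indicator {0<..1} x * (x powr - \<gamma> * (1 - exp (- (\<delta> / real q) / x powr p))))"
    proof (cases "0 < x \<and> x \<le> 1")
      case True
      then show ?thesis
        using \<delta> width_powr_le[of x] by (simp add: width_powr mult_ac flip: ennreal_mult)
    qed (auto simp: indicator_def)
  qed
  also have "\<dots> = ennreal (2 / \<delta>) * ennreal (layer_integral ((1 - \<gamma>) / p) (\<delta> / real q) / (1 - \<gamma>))"
    unfolding nn_integral_flat_layer[OF \<gamma> divide_pos_pos[OF \<delta> q0] p, symmetric]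
    by (rule nn_integral_cmult) measurable
  also have "2 * \<dots> = ennreal (mass \<delta>)"
    using \<delta> \<gamma> layer0 unfolding mass_def \<gamma>_def[symmetric]
    by (simp add: two_mult_ennreal flip: ennreal_mult)
  finally show "(\<integral>\<^sup>+z. ennreal (main_term ((\<delta> - 1) / real b) z) \<partial>lborel) = ennreal (mass \<delta>)" .
  show "0 \<le> mass \<delta>"
    using \<delta> \<gamma> layer0 unfolding mass_def \<gamma>_def[symmetric] by simp
qed (auto simp: main_term_nonneg)

text \<open>The integral in \<open>y\<close> is \<open>- 2 ln (width x) = 2 / (q \<bar>x\<bar>\<^sup>p)\<close>, and \<open>\<bar>x\<bar>\<^sup>-\<^sup>\<alpha>\<^sup>-\<^sup>p\<close> is integrable at \<open>0\<close>.\<close>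

lemma integrable_main_term_critical:
  assumes "p < 1 - \<alpha>"
  shows "integrable lborel (main_term (- 1 / real b))"
proof (rule integrableI_nonneg)
  have q0: "0 < real q" using q by simp
  have ex: "real a * (- 1 / real b) = - \<alpha>" "real b * (- 1 / real b) = - 1"
    using b_pos by (auto simp: \<alpha>_def)
  have "(\<integral>\<^sup>+z. ennreal (main_term (- 1 / real b) z) \<partial>lborel)
      = (\<integral>\<^sup>+x. ennreal (indicator {-1..1} x * \<bar>x\<bar> powr - \<alpha>) * ennreal (2 * - ln (width x)) \<partial>lborel)"
    unfolding nn_integral_main_term_iterated ex using width
    by (simp only: nn_integral_annulus_log)
  also have "\<dots> = (\<integral>\<^sup>+x. ennreal (2 / real q * (indicator {-1..1} x * \<bar>x\<bar> powr (- \<alpha> - p))) \<partial>lborel)"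
  proof (rule nn_integral_cong)
    fix x :: real
    show "ennreal (indicator {-1..1} x * \<bar>x\<bar> powr - \<alpha>) * ennreal (2 * - ln (width x))
      = ennreal (2 / real q * (indicator {-1..1} x * \<bar>x\<bar> powr (- \<alpha> - p)))"
      using q0 by (cases "x = 0") (auto simp: width_def powr_diff field_simps simp flip: ennreal_mult)
  qed
  also have "\<dots> < \<infinity>"
  proof -
    have "integrable lborel (\<lambda>x. 2 / real q * (indicator {-1..1} x * \<bar>x\<bar> powr (- \<alpha> - p)))"
      using assms by (intro integrable_mult_right integrable_abs_powr) auto
    from nn_integral_eq_integral[OF this] show ?thesis by simp
  qed
  finally show "(\<integral>\<^sup>+z. ennreal (main_term (- 1 / real b) z) \<partial>lborel) < \<infinity>" .
qed (auto simp: main_term_nonneg)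

lemma main_term_le_critical:
  assumes "- 1 / real b \<le> \<sigma>"
  shows "main_term \<sigma> z \<le> main_term (- 1 / real b) z"
proof (cases z)
  case (Pair x y)
  have "\<bar>x\<bar> powr (real a * \<sigma>) * \<bar>y\<bar> powr (real b * \<sigma>)
      \<le> \<bar>x\<bar> powr (real a * (- 1 / real b)) * \<bar>y\<bar> powr (real b * (- 1 / real b))"
    if "(x, y) \<in> main_zone"
    using that assms a b_pos
    by (intro mult_mono powr_mono' mult_left_mono) (auto simp: main_zone_def)
  then show ?thesis
    unfolding Pair main_term_def prod.case
    by (cases "(x, y) \<in> main_zone")
      (simp_all only: indicator_simps not_False_eq_True mult_1 mult_zero_left order_refl)
qed

lemma error_bound_measurable [measurable]: "error_bound C \<in> borel_measurable borel"
  using width_measurable unfolding error_bound_def borel_prod[symmetric] by measurable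

lemma error_bound_nonneg: "0 \<le> C \<Longrightarrow> 0 \<le> error_bound C z"
  by (cases z) (simp add: error_bound_def transition_nonneg)

lemma integrable_unit_interval: "integrable lborel (indicator {-1..1} :: real \<Rightarrow> real)"
  by (simp add: integrable_indicator_iff)

text \<open>The \<open>y\<close>-integral of the transition term is bounded uniformly in \<open>x\<close>, which leaves powers of \<open>\<bar>x\<bar>\<close> greater
  than \<open>-1\<close>.\<close>

lemma integrable_error_bound:
  shows "integrable lborel (\<lambda>z. indicator square z * error_bound C z)"
proof -
  define t where "t = (\<lambda>(x, y). \<bar>x\<bar> powr - \<alpha> * transition (real q / real b) (width x) y)"
  have t [measurable]: "t \<in> borel_measurable borel"
    using width_measurable unfolding t_def borel_prod[symmetric] by measurable
  have t0: "0 \<le> t z" for z by (cases z) (simp add: t_def transition_nonneg)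
  have "integrable lborel (\<lambda>z. indicator square z * t z)"
  proof (rule integrableI_nonneg)
    have "(\<integral>\<^sup>+z. ennreal (indicator square z * t z) \<partial>lborel)
        = (\<integral>\<^sup>+x. \<integral>\<^sup>+y. ennreal (indicator square (x, y) * t (x, y)) \<partial>lborel \<partial>lborel)"
      by (rule nn_integral_lborel_pair) simp
    also have "\<dots> \<le> (\<integral>\<^sup>+x. ennreal (4 * real b / real q * (indicator {-1..1} x * \<bar>x\<bar> powr - \<alpha>)) \<partial>lborel)"
    proof (rule nn_integral_mono)
      fix x :: real
      have "(\<integral>\<^sup>+y. ennreal (indicator square (x, y) * t (x, y)) \<partial>lborel)
          \<le> (\<integral>\<^sup>+y. ennreal (indicator {-1..1} x * \<bar>x\<bar> powr - \<alpha>) * ennreal (transition (real q / real b) (width x) y) \<partial>lborel)"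
        by (intro nn_integral_mono)
          (auto simp: t_def square_def indicator_def transition_nonneg simp flip: ennreal_mult)
      also have "\<dots> = ennreal (indicator {-1..1} x * \<bar>x\<bar> powr - \<alpha>)
          * (\<integral>\<^sup>+y. ennreal (transition (real q / real b) (width x) y) \<partial>lborel)"
        by (intro nn_integral_cmult) auto
      also have "\<dots> \<le> ennreal (indicator {-1..1} x * \<bar>x\<bar> powr - \<alpha>) * ennreal (4 / (real q / real b))"
        using q b_pos width by (intro mult_left_mono nn_integral_transition_le) auto
      also have "\<dots> = ennreal (4 * real b / real q * (indicator {-1..1} x * \<bar>x\<bar> powr - \<alpha>))"
        by (simp add: mult_ac flip: ennreal_mult)
      finally show "(\<integral>\<^sup>+y. ennreal (indicator square (x, y) * t (x, y)) \<partial>lborel)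
          \<le> ennreal (4 * real b / real q * (indicator {-1..1} x * \<bar>x\<bar> powr - \<alpha>))" .
    qed
    also have "\<dots> < \<infinity>"
    proof -
      have "integrable lborel (\<lambda>x. 4 * real b / real q * (indicator {-1..1} x * \<bar>x\<bar> powr - \<alpha>))"
        using \<alpha> by (intro integrable_mult_right integrable_abs_powr) auto
      from nn_integral_eq_integral[OF this] show ?thesis by simp
    qed
    finally show "(\<integral>\<^sup>+z. ennreal (indicator square z * t z) \<partial>lborel) < \<infinity>" .
  qed (auto simp: t0)
  moreover have "integrable lborel (\<lambda>z. C * ((indicator {-1..1} (fst z) * \<bar>fst z\<bar> powr - ((1 + \<alpha>) / 2))
      * indicator {-1..1::real} (snd z)))"
    using \<alpha> by (intro integrable_mult_right integrable_lborel_pair_mult integrable_abs_powr integrable_unit_interval) auto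
  ultimately have "integrable lborel (\<lambda>z. indicator square z * t z
      + C * ((indicator {-1..1} (fst z) * \<bar>fst z\<bar> powr - ((1 + \<alpha>) / 2)) * indicator {-1..1::real} (snd z)))"
    by (rule Bochner_Integration.integrable_add)
  then show ?thesis
    by (rule Bochner_Integration.integrable_cong[THEN iffD1, rotated -1])
      (auto simp: square_def t_def error_bound_def indicator_def split: prod.splits)
qed

text \<open>On the cut-off region \<open>\<bar>y\<bar>\<close> can be small only if \<open>x\<close> is, so away from the origin the pole \<open>1 / \<bar>y\<bar>\<close> is
  bounded and only the integrable singularity in \<open>x\<close> remains.\<close>

lemma main_term_bounded_away_from_origin:
  assumes \<epsilon>: "0 < \<epsilon>"
  obtains c where "0 \<le> c"
    "\<And>x y \<sigma>. \<lbrakk>- 1 / real b \<le> \<sigma>; \<bar>x\<bar> \<ge> \<epsilon> \<or> \<bar>y\<bar> \<ge> \<epsilon>\<rbrakk>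
       \<Longrightarrow> main_term \<sigma> (x, y)
           \<le> c * ((indicator {-1..1} x * \<bar>x\<bar> powr - \<alpha>) * indicator {-1..1} y)"
proof
  define c where "c = max (1 / \<epsilon>) (1 / width \<epsilon>)"
  show "0 \<le> c" using \<epsilon> by (simp add: c_def le_max_iff_disj)
  fix x y \<sigma> :: real
  assume \<sigma>: "- 1 / real b \<le> \<sigma>" and away: "\<bar>x\<bar> \<ge> \<epsilon> \<or> \<bar>y\<bar> \<ge> \<epsilon>"
  have "1 / \<bar>y\<bar> \<le> c" if zone: "(x, y) \<in> main_zone"
  proof (cases "\<bar>y\<bar> \<ge> \<epsilon>")
    case True
    then have "1 / \<bar>y\<bar> \<le> 1 / \<epsilon>" using \<epsilon> by (simp add: frac_le)
    then show ?thesis by (simp add: c_def)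
  next
    case False
    then have x: "\<epsilon> \<le> \<bar>x\<bar>" using away by blast
    have "\<epsilon> powr p \<le> \<bar>x\<bar> powr p" using \<epsilon> x p by (intro powr_mono2) auto
    then have "width \<epsilon> \<le> width x"
      using \<epsilon> q x by (auto simp: width_def intro!: divide_left_mono mult_pos_pos mult_left_mono)
    then have "width \<epsilon> \<le> \<bar>y\<bar>" using zone by (simp add: main_zone_def)
    then have "1 / \<bar>y\<bar> \<le> 1 / width \<epsilon>" using width[of \<epsilon>] by (simp add: frac_le)
    then show ?thesis by (simp add: c_def)
  qed
  then have "\<bar>x\<bar> powr - \<alpha> * (1 / \<bar>y\<bar>) \<le> \<bar>x\<bar> powr - \<alpha> * c" if "(x, y) \<in> main_zone"
    using that by (intro mult_left_mono) auto
  then have "main_term (- 1 / real b) (x, y) \<le> c * ((indicator {-1..1} x * \<bar>x\<bar> powr - \<alpha>) * indicator {-1..1} y)"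
    using b_pos \<open>0 \<le> c\<close>
    by (auto simp: main_term_def \<alpha>_def main_zone_def indicator_def powr_minus_divide[of _ 1] mult.commute)
  then show "main_term \<sigma> (x, y) \<le> c * ((indicator {-1..1} x * \<bar>x\<bar> powr - \<alpha>) * indicator {-1..1} y)"
    using main_term_le_critical[OF \<sigma>, of "(x, y)"] by linarith
qed

section \<open>Concentration of the zeta integral at the origin\<close>

lemma F_nonzero: "x \<noteq> 0 \<Longrightarrow> y \<noteq> 0 \<Longrightarrow> F (x, y) \<noteq> 0"
proof -
  assume "x \<noteq> 0" "y \<noteq> 0"
  then have "0 < \<bar>F (x, y)\<bar>"
    by (intro less_le_trans[OF _ abs_F_ge(1)]) auto
  then show ?thesis by simp
qed

lemma abs_F_le_3:
  assumes "\<bar>x\<bar> \<le> 1" "\<bar>y\<bar> \<le> 1"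
  shows "\<bar>F (x, y)\<bar> \<le> 3"
proof -
  have pow: "\<bar>u ^ k\<bar> \<le> 1" if "\<bar>u\<bar> \<le> 1" for u :: real and k
    using that by (simp add: power_abs power_le_one)
  have flat: "\<bar>flat r u\<bar> \<le> 1" for r u by (simp add: flat_def)
  have "\<bar>x ^ a * y ^ b\<bar> \<le> 1" "\<bar>x ^ a * y ^ (b - q) * flat p x\<bar> \<le> 1"
    "\<bar>x ^ (a - q') * y ^ b * flat p' y\<bar> \<le> 1"
    unfolding abs_mult using assms by (auto intro!: mult_le_one pow flat)
  then show ?thesis
    unfolding flat_perturbed_monomial_def by simp
qed

text \<open>For negative \<open>\<sigma>\<close> the inequality \<open>\<bar>F\<bar> \<ge> \<bar>x\<bar>\<^sup>a \<bar>y\<bar>\<^sup>b\<close> reduces the claim to powers greater than \<open>-1\<close> in each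
  variable; for nonnegative \<open>\<sigma>\<close> the integrand is bounded.\<close>

lemma integrable_abs_F_powr:
  fixes \<phi> :: "real \<times> real \<Rightarrow> real"
  assumes \<sigma>: "- 1 / real b < \<sigma>" and [measurable]: "\<phi> \<in> borel_measurable borel"
    and B: "0 \<le> B" "\<And>z. \<bar>\<phi> z\<bar> \<le> B" and supp: "\<And>z. z \<notin> square \<Longrightarrow> \<phi> z = 0"
  shows "integrable lborel (\<lambda>z. \<bar>F z\<bar> powr \<sigma> * \<phi> z)"
proof -
  define \<tau> where "\<tau> = min \<sigma> 0"
  have \<tau>: "- 1 < real a * \<tau>" "- 1 < real b * \<tau>"
  proof -
    show "- 1 < real b * \<tau>" using \<sigma> b_pos by (auto simp: \<tau>_def min_def field_simps)
    moreover have "real b * \<tau> \<le> real a * \<tau>"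
      using ab by (intro mult_right_mono_neg) (auto simp: \<tau>_def)
    ultimately show "- 1 < real a * \<tau>" by linarith
  qed
  define g where "g = (\<lambda>z. B * ((indicator {-1..1} (fst z) * \<bar>fst z\<bar> powr (real a * \<tau>))
      * (indicator {-1..1} (snd z) * \<bar>snd z\<bar> powr (real b * \<tau>)))
      + B * 3 powr \<sigma> * (indicator {-1..1::real} (fst z) * indicator {-1..1::real} (snd z)))"
  have "integrable lborel g"
    unfolding g_def using \<tau>
    by (intro Bochner_Integration.integrable_add integrable_mult_right integrable_lborel_pair_mult
        integrable_abs_powr integrable_unit_interval)
  then show ?thesis
  proof (rule Bochner_Integration.integrable_bound)
    show "AE z in lborel. norm (\<bar>F z\<bar> powr \<sigma> * \<phi> z) \<le> norm (g z)"
      using AE_lborel_pair_nonzero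
    proof eventually_elim
      fix z :: "real \<times> real"
      assume nz: "fst z \<noteq> 0 \<and> snd z \<noteq> 0"
      show "norm (\<bar>F z\<bar> powr \<sigma> * \<phi> z) \<le> norm (g z)"
      proof (cases "z \<in> square")
        case True
        obtain x y where z: "z = (x, y)" by (cases z)
        have xy: "x \<noteq> 0" "y \<noteq> 0" "\<bar>x\<bar> \<le> 1" "\<bar>y\<bar> \<le> 1"
          using True nz by (auto simp: z square_def)
        have "\<bar>F (x, y)\<bar> powr \<sigma> \<le> \<bar>x\<bar> powr (real a * \<tau>) * \<bar>y\<bar> powr (real b * \<tau>) + 3 powr \<sigma>"
        proof (cases "0 \<le> \<sigma>")
          case True
          then have "\<bar>F (x, y)\<bar> powr \<sigma> \<le> 3 powr \<sigma>"
            using abs_F_le_3[OF xy(3,4)] by (intro powr_mono2) auto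
          moreover have "0 \<le> \<bar>x\<bar> powr (real a * \<tau>) * \<bar>y\<bar> powr (real b * \<tau>)" by simp
          ultimately show ?thesis by linarith
        next
          case False
          then have \<tau>: "\<tau> = \<sigma>" by (simp add: \<tau>_def)
          have "\<bar>F (x, y)\<bar> powr \<sigma> \<le> (\<bar>x\<bar> ^ a * \<bar>y\<bar> ^ b) powr \<sigma>"
            using False xy abs_F_ge(1)[OF xy(1,2)] by (intro powr_mono2') auto
          moreover have "(\<bar>x\<bar> ^ a * \<bar>y\<bar> ^ b) powr \<sigma> = \<bar>x\<bar> powr (real a * \<tau>) * \<bar>y\<bar> powr (real b * \<tau>)"
            unfolding \<tau> using xy by (intro monomial_powr) auto
          moreover have "(0::real) \<le> 3 powr \<sigma>" by simp
          ultimately show ?thesis by linarith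
        qed
        then have "\<bar>F (x, y)\<bar> powr \<sigma> * \<bar>\<phi> z\<bar>
            \<le> (\<bar>x\<bar> powr (real a * \<tau>) * \<bar>y\<bar> powr (real b * \<tau>) + 3 powr \<sigma>) * B"
          using B by (intro mult_mono) auto
        also have "\<dots> = g z"
          using xy by (simp add: g_def z indicator_def abs_le_iff algebra_simps)
        finally show ?thesis by (simp add: abs_mult z)
      qed (simp add: supp)
    qed
  qed auto
qed

lemma integrable_zeta_integrand:
  fixes \<phi> :: "real \<times> real \<Rightarrow> real"
  assumes s: "- 1 / real b < Re s" and [measurable]: "\<phi> \<in> borel_measurable borel"
    and B: "0 \<le> B" "\<And>z. \<bar>\<phi> z\<bar> \<le> B" and supp: "\<And>z. z \<notin> square \<Longrightarrow> \<phi> z = 0"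
  shows "integrable lborel (\<lambda>z. complex_of_real \<bar>F z\<bar> powr s * complex_of_real (\<phi> z))"
proof (rule Bochner_Integration.integrable_bound)
  show "integrable lborel (\<lambda>z. \<bar>F z\<bar> powr Re s * \<phi> z)"
    using assms by (rule integrable_abs_F_powr)
  show "AE z in lborel. norm (complex_of_real \<bar>F z\<bar> powr s * complex_of_real (\<phi> z))
      \<le> norm (\<bar>F z\<bar> powr Re s * \<phi> z)"
    by (intro AE_I2) (simp add: norm_mult abs_mult norm_powr_real_powr)
  have "(\<lambda>z. complex_of_real \<bar>F z\<bar> powr s)
      = (\<lambda>z. if F z = 0 then 0 else exp (s * complex_of_real (ln \<bar>F z\<bar>)))"
    by (auto simp: powr_def Ln_of_real)
  then show "(\<lambda>z. complex_of_real \<bar>F z\<bar> powr s * complex_of_real (\<phi> z)) \<in> borel_measurable lborel"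
    by simp
qed

text \<open>The local zeta function on the real axis, in the variable \<open>\<delta> = b \<sigma> + 1\<close> that vanishes at the
  abscissa \<open>-1/b\<close>.\<close>

definition zeta :: "(real \<times> real \<Rightarrow> real) \<Rightarrow> real \<Rightarrow> real"
  where "zeta \<phi> \<delta> = (LINT z|lborel. \<bar>F z\<bar> powr ((\<delta> - 1) / real b) * \<phi> z)"

lemma local_zeta_real: "local_zeta F \<phi> (complex_of_real \<sigma>) = complex_of_real (zeta \<phi> (real b * \<sigma> + 1))"
  using b_pos by (simp add: local_zeta_def zeta_def powr_of_real flip: of_real_mult)

text \<open>Replacing \<open>\<bar>F\<bar>\<^sup>\<sigma>\<close> by the main term costs a bounded amount. Replacing \<open>\<phi>\<close> by \<open>\<phi>(0, 0)\<close> costs at most \<open>\<eta>\<close>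
  times the mass near the origin, by continuity, and again a bounded amount elsewhere.\<close>

lemma zeta_approximates_mass:
  fixes \<phi> :: "real \<times> real \<Rightarrow> real"
  assumes cont: "continuous_on UNIV \<phi>"
    and B: "0 \<le> B" "\<And>z. \<bar>\<phi> z\<bar> \<le> B" and supp: "\<And>z. z \<notin> square \<Longrightarrow> \<phi> z = 0"
    and \<eta>: "0 < \<eta>"
  obtains R where "\<And>\<delta>. \<lbrakk>0 < \<delta>; \<delta> < 1\<rbrakk> \<Longrightarrow> \<bar>zeta \<phi> \<delta> - \<phi> (0, 0) * mass \<delta>\<bar> \<le> \<eta> * mass \<delta> + R"
proof -
  have \<phi> [measurable]: "\<phi> \<in> borel_measurable borel"
    using cont by (rule borel_measurable_continuous_onI)
  obtain d where d: "0 < d" "\<And>z. dist z (0, 0) < d \<Longrightarrow> \<bar>\<phi> z - \<phi> (0, 0)\<bar> < \<eta>"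
    using cont \<eta> by (fastforce simp: continuous_on_iff dist_real_def)
  \<comment> \<open>The square of half-side \<open>d / 2\<close> around the origin lies in the disc of radius \<open>d\<close>.\<close>
  define \<epsilon> where "\<epsilon> = d / 2"
  have \<epsilon>: "0 < \<epsilon>" using d by (simp add: \<epsilon>_def)
  have near: "\<bar>\<phi> (x, y) - \<phi> (0, 0)\<bar> \<le> \<eta>" if "\<bar>x\<bar> < \<epsilon>" "\<bar>y\<bar> < \<epsilon>" for x y
  proof -
    have "dist (x, y) (0, 0) \<le> \<bar>x\<bar> + \<bar>y\<bar>"
      using sqrt_sum_squares_le_sum_abs[of x y] by (simp add: dist_Pair_Pair)
    then show ?thesis using d(2)[of "(x, y)"] that by (auto simp: \<epsilon>_def)
  qed
  obtain C where C: "0 \<le> C"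
    "\<And>x y \<sigma>. \<lbrakk>0 < \<bar>x\<bar>; \<bar>x\<bar> \<le> 1; 0 < \<bar>y\<bar>; \<bar>y\<bar> \<le> 1; - 1 / real b \<le> \<sigma>; \<sigma> < 0\<rbrakk>
       \<Longrightarrow> \<bar>\<bar>F (x, y)\<bar> powr \<sigma> - main_term \<sigma> (x, y)\<bar> \<le> error_bound C (x, y)"
    using abs_F_powr_near_monomial by blast
  obtain c where c: "0 \<le> c"
    "\<And>x y \<sigma>. \<lbrakk>- 1 / real b \<le> \<sigma>; \<bar>x\<bar> \<ge> \<epsilon> \<or> \<bar>y\<bar> \<ge> \<epsilon>\<rbrakk>
       \<Longrightarrow> main_term \<sigma> (x, y)
           \<le> c * ((indicator {-1..1} x * \<bar>x\<bar> powr - \<alpha>) * indicator {-1..1} y)"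
    using main_term_bounded_away_from_origin[OF \<epsilon>] by blast
  define far where "far = (\<lambda>z. c * ((indicator {-1..1} (fst z) * \<bar>fst z\<bar> powr - \<alpha>) * indicator {-1..1::real} (snd z)))"
  define err where "err = (\<lambda>z. indicator square z * error_bound C z)"
  have far_int: "integrable lborel far"
    unfolding far_def using \<alpha>
    by (intro integrable_mult_right integrable_lborel_pair_mult integrable_abs_powr integrable_unit_interval) auto
  have err_int: "integrable lborel err"
    unfolding err_def by (rule integrable_error_bound)
  have far0: "0 \<le> far z" and err0: "0 \<le> err z" for z
    using C(1) c(1) by (auto simp: far_def err_def error_bound_nonneg)
  show ?thesis
  proof (rule that)
    fix \<delta> :: real assume \<delta>: "0 < \<delta>" "\<delta> < 1"
    define \<sigma> where "\<sigma> = (\<delta> - 1) / real b"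
    have \<sigma>: "- 1 / real b < \<sigma>" "\<sigma> < 0"
      using \<delta> b_pos by (auto simp: \<sigma>_def field_simps)
    have main: "integrable lborel (main_term \<sigma>)" "(LINT z|lborel. main_term \<sigma> z) = mass \<delta>"
      using has_bochner_integral_main_term[OF \<delta>(1)] by (auto simp: \<sigma>_def has_bochner_integral_iff)
    have F_int: "integrable lborel (\<lambda>z. \<bar>F z\<bar> powr \<sigma> * \<phi> z)"
      using \<sigma>(1) \<phi> B supp by (rule integrable_abs_F_powr)
    have bound: "\<bar>\<bar>F z\<bar> powr \<sigma> * \<phi> z - \<phi> (0, 0) * main_term \<sigma> z\<bar>
        \<le> B * err z + (\<eta> * main_term \<sigma> z + 2 * B * far z)"
      if nz: "fst z \<noteq> 0 \<and> snd z \<noteq> 0" for z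
    proof (cases "z \<in> square")
      case True
      obtain x y where z: "z = (x, y)" by (cases z)
      have xy: "0 < \<bar>x\<bar>" "0 < \<bar>y\<bar>" "\<bar>x\<bar> \<le> 1" "\<bar>y\<bar> \<le> 1"
        using True nz by (auto simp: z square_def)
      have "\<bar>F z\<bar> powr \<sigma> * \<phi> z - \<phi> (0, 0) * main_term \<sigma> z
          = (\<bar>F z\<bar> powr \<sigma> - main_term \<sigma> z) * \<phi> z + main_term \<sigma> z * (\<phi> z - \<phi> (0, 0))"
        by (simp add: algebra_simps)
      then have "\<bar>\<bar>F z\<bar> powr \<sigma> * \<phi> z - \<phi> (0, 0) * main_term \<sigma> z\<bar>
          \<le> \<bar>\<bar>F z\<bar> powr \<sigma> - main_term \<sigma> z\<bar> * \<bar>\<phi> z\<bar> + main_term \<sigma> z * \<bar>\<phi> z - \<phi> (0, 0)\<bar>"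
        using abs_triangle_ineq[of "(\<bar>F z\<bar> powr \<sigma> - main_term \<sigma> z) * \<phi> z"
            "main_term \<sigma> z * (\<phi> z - \<phi> (0, 0))"] main_term_nonneg[of \<sigma> z]
        by (simp add: abs_mult)
      also have "\<dots> \<le> err z * B + (main_term \<sigma> z * \<eta> + far z * (2 * B))"
      proof (rule add_mono)
        have "\<bar>\<bar>F z\<bar> powr \<sigma> - main_term \<sigma> z\<bar> \<le> err z"
          using C(2)[of x y \<sigma>] xy \<sigma> True by (simp add: z err_def)
        then show "\<bar>\<bar>F z\<bar> powr \<sigma> - main_term \<sigma> z\<bar> * \<bar>\<phi> z\<bar> \<le> err z * B"
          using B err0 by (intro mult_mono) auto
        show "main_term \<sigma> z * \<bar>\<phi> z - \<phi> (0, 0)\<bar> \<le> main_term \<sigma> z * \<eta> + far z * (2 * B)"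
        proof (cases "\<bar>x\<bar> < \<epsilon> \<and> \<bar>y\<bar> < \<epsilon>")
          case True
          then have "main_term \<sigma> z * \<bar>\<phi> z - \<phi> (0, 0)\<bar> \<le> main_term \<sigma> z * \<eta>"
            using near main_term_nonneg[of \<sigma> z] by (intro mult_left_mono) (auto simp: z)
          moreover have "0 \<le> far z * (2 * B)" using far0 B(1) by simp
          ultimately show ?thesis by linarith
        next
          case False
          have "main_term \<sigma> z * \<bar>\<phi> z - \<phi> (0, 0)\<bar> \<le> far z * (2 * B)"
          proof (rule mult_mono)
            show "main_term \<sigma> z \<le> far z"
              using c(2)[of \<sigma> x y] \<sigma> False by (auto simp: far_def z)
            show "\<bar>\<phi> z - \<phi> (0, 0)\<bar> \<le> 2 * B"
              using B(2)[of z] B(2)[of "(0, 0)"] by linarith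
          qed (use far0 in auto)
          moreover have "0 \<le> main_term \<sigma> z * \<eta>" using main_term_nonneg[of \<sigma> z] \<eta> by simp
          ultimately show ?thesis by linarith
        qed
      qed
      finally show ?thesis by (simp add: mult_ac)
    next
      case False
      then have "main_term \<sigma> z = 0"
        by (cases z) (auto simp: main_term_def main_zone_def square_def)
      then show ?thesis using False supp far0 err0 B(1) by simp
    qed
    have "zeta \<phi> \<delta> - \<phi> (0, 0) * mass \<delta>
        = (LINT z|lborel. \<bar>F z\<bar> powr \<sigma> * \<phi> z - \<phi> (0, 0) * main_term \<sigma> z)"
      using F_int main by (simp add: zeta_def \<sigma>_def)
    also have "\<bar>\<dots>\<bar> \<le> (LINT z|lborel. \<bar>\<bar>F z\<bar> powr \<sigma> * \<phi> z - \<phi> (0, 0) * main_term \<sigma> z\<bar>)"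
      by (rule integral_abs_bound)
    also have "\<dots> \<le> (LINT z|lborel. B * err z + (\<eta> * main_term \<sigma> z + 2 * B * far z))"
    proof (rule integral_mono_AE)
      show "AE z in lborel. \<bar>\<bar>F z\<bar> powr \<sigma> * \<phi> z - \<phi> (0, 0) * main_term \<sigma> z\<bar>
          \<le> B * err z + (\<eta> * main_term \<sigma> z + 2 * B * far z)"
        using AE_lborel_pair_nonzero by eventually_elim (rule bound)
    qed (use F_int main far_int err_int in auto)
    also have "\<dots> = \<eta> * mass \<delta> + (B * (LINT z|lborel. err z) + 2 * B * (LINT z|lborel. far z))"
      using main far_int err_int by simp
    finally show "\<bar>zeta \<phi> \<delta> - \<phi> (0, 0) * mass \<delta>\<bar>
        \<le> \<eta> * mass \<delta> + (B * (LINT z|lborel. err z) + 2 * B * (LINT z|lborel. far z))" .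
  qed
qed

text \<open>After multiplication by a factor \<open>N\<close> that tends to \<open>0\<close>, the bounded errors disappear and the error
  proportional to the mass is at most \<open>\<eta> c\<close> in the limit, with \<open>\<eta>\<close> arbitrary.\<close>

lemma normalized_zeta_limit:
  fixes \<phi> :: "real \<times> real \<Rightarrow> real"
  assumes cont: "continuous_on UNIV \<phi>"
    and B: "0 \<le> B" "\<And>z. \<bar>\<phi> z\<bar> \<le> B" and supp: "\<And>z. z \<notin> square \<Longrightarrow> \<phi> z = 0"
    and N_nonneg: "\<And>\<delta>. 0 \<le> N \<delta>" and N: "(N \<longlongrightarrow> 0) (at_right 0)"
    and mass: "((\<lambda>\<delta>. N \<delta> * mass \<delta>) \<longlongrightarrow> c) (at_right 0)"
  shows "((\<lambda>\<delta>. N \<delta> * zeta \<phi> \<delta>) \<longlongrightarrow> c * \<phi> (0, 0)) (at_right 0)"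
proof -
  have "((\<lambda>\<delta>. N \<delta> * (zeta \<phi> \<delta> - \<phi> (0, 0) * mass \<delta>)) \<longlongrightarrow> 0) (at_right 0)"
  proof (rule tendstoI)
    fix e :: real assume e: "0 < e"
    \<comment> \<open>The added \<open>1\<close> avoids a division by zero for \<open>c = 0\<close>.\<close>
    define \<eta> where "\<eta> = e / (2 * (\<bar>c\<bar> + 1))"
    have \<eta>: "0 < \<eta>" "\<eta> * c < e"
    proof -
      show "0 < \<eta>" using e by (simp add: \<eta>_def)
      then have "\<eta> * c \<le> \<eta> * (\<bar>c\<bar> + 1)" by (intro mult_left_mono) auto
      also have "\<dots> = e / 2" by (simp add: \<eta>_def field_simps)
      finally show "\<eta> * c < e" using e by simp
    qed
    obtain R where R: "\<And>\<delta>. \<lbrakk>0 < \<delta>; \<delta> < 1\<rbrakk>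
        \<Longrightarrow> \<bar>zeta \<phi> \<delta> - \<phi> (0, 0) * mass \<delta>\<bar> \<le> \<eta> * mass \<delta> + R"
      using zeta_approximates_mass[OF cont B supp \<eta>(1)] by blast
    have "((\<lambda>\<delta>. \<eta> * (N \<delta> * mass \<delta>) + N \<delta> * R) \<longlongrightarrow> \<eta> * c + 0 * R) (at_right 0)"
      by (intro tendsto_intros mass N)
    then have "\<forall>\<^sub>F \<delta> in at_right 0. \<eta> * (N \<delta> * mass \<delta>) + N \<delta> * R < e"
      using \<eta>(2) by (intro order_tendstoD(2)) auto
    moreover have "\<forall>\<^sub>F \<delta>::real in at_right 0. 0 < \<delta> \<and> \<delta> < 1"
      by (auto simp: eventually_at_right_field intro!: exI[of _ 1])
    ultimately show "\<forall>\<^sub>F \<delta> in at_right 0. dist (N \<delta> * (zeta \<phi> \<delta> - \<phi> (0, 0) * mass \<delta>)) 0 < e"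
    proof eventually_elim
      case (elim \<delta>)
      have "N \<delta> * \<bar>zeta \<phi> \<delta> - \<phi> (0, 0) * mass \<delta>\<bar> \<le> N \<delta> * (\<eta> * mass \<delta> + R)"
        using elim R N_nonneg by (intro mult_left_mono) auto
      also have "\<dots> < e" using elim by (simp add: algebra_simps)
      finally show ?case using N_nonneg[of \<delta>] by (simp add: abs_mult)
    qed
  qed
  from tendsto_add[OF this tendsto_mult_right[OF mass, of "\<phi> (0, 0)"]]
  show ?thesis by (simp add: algebra_simps)
qed

text \<open>With \<open>T = \<delta> / q\<close> the exponent in the mass is \<open>\<kappa> + c T\<close> for \<open>\<kappa> = (1 - \<alpha>) / p\<close> and \<open>c = \<alpha> q / p\<close>.\<close>

lemma mass_power_asymptotics:
  assumes p_gt: "1 - \<alpha> < p"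
  shows "((\<lambda>\<delta>. \<delta> powr (1 - (1 - \<alpha>) / p) * mass \<delta>) \<longlongrightarrow>
    4 * (1 / (real q powr ((1 - \<alpha>) / p) * (1 - \<alpha>)) * Gamma (1 - (1 - \<alpha>) / p))) (at_right 0)"
proof -
  define \<kappa> c where "\<kappa> = (1 - \<alpha>) / p" and "c = \<alpha> * real q / p"
  have q0: "0 < real q" using q by simp
  have \<kappa>: "0 < \<kappa>" "\<kappa> < 1" and c: "0 \<le> c"
    using p p_gt \<alpha> by (auto simp: \<kappa>_def c_def)
  have "filterlim (\<lambda>\<delta>. \<delta> / real q) (at_right 0) (at_right 0)"
    using q0 by real_asymp
  from filterlim_compose[OF layer_integral_power_asymptotics[OF \<kappa> c] this]
  have "((\<lambda>\<delta>. 4 / (real q powr \<kappa> * (1 - \<alpha> * (1 - \<delta>)))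
      * ((\<delta> / real q) powr - \<kappa> * layer_integral (\<kappa> + c * (\<delta> / real q)) (\<delta> / real q)))
      \<longlongrightarrow> 4 / (real q powr \<kappa> * (1 - \<alpha> * (1 - 0))) * Gamma (1 - \<kappa>)) (at_right 0)"
    using q0 \<alpha> by (intro tendsto_intros) auto
  moreover have "\<forall>\<^sub>F \<delta> in at_right 0. 4 / (real q powr \<kappa> * (1 - \<alpha> * (1 - \<delta>)))
      * ((\<delta> / real q) powr - \<kappa> * layer_integral (\<kappa> + c * (\<delta> / real q)) (\<delta> / real q))
      = \<delta> powr (1 - \<kappa>) * mass \<delta>"
  proof (rule eventually_at_rightI[of 0 1])
    fix \<delta> :: real assume "\<delta> \<in> {0<..<1}"
    then have \<delta>: "0 < \<delta>" by simp
    have "(1 - \<alpha> * (1 - \<delta>)) / p = \<kappa> + c * (\<delta> / real q)"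
      using p q0 by (simp add: \<kappa>_def c_def field_simps)
    then have m: "mass \<delta> = 4 / (\<delta> * (1 - \<alpha> * (1 - \<delta>))) * layer_integral (\<kappa> + c * (\<delta> / real q)) (\<delta> / real q)"
      by (simp add: mass_def)
    have "4 / (real q powr \<kappa> * D) * ((\<delta> / real q) powr - \<kappa> * M) = \<delta> powr (1 - \<kappa>) * (4 / (\<delta> * D) * M)"
      if "D \<noteq> 0" for D M :: real
      using that \<delta> q0 by (simp add: powr_divide powr_diff powr_minus field_simps)
    from this[of "1 - \<alpha> * (1 - \<delta>)"] exponent_less_1[OF \<delta>]
    show "4 / (real q powr \<kappa> * (1 - \<alpha> * (1 - \<delta>)))
      * ((\<delta> / real q) powr - \<kappa> * layer_integral (\<kappa> + c * (\<delta> / real q)) (\<delta> / real q))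
      = \<delta> powr (1 - \<kappa>) * mass \<delta>"
      unfolding m by simp
  qed simp
  ultimately show ?thesis
    unfolding \<kappa>_def[symmetric] by (auto elim: Lim_transform_eventually)
qed

lemma mass_log_asymptotics:
  assumes p_eq: "p = 1 - \<alpha>"
  shows "((\<lambda>\<delta>. inverse \<bar>ln \<delta>\<bar> * mass \<delta>) \<longlongrightarrow> 4 / (p * real q)) (at_right 0)"
proof -
  define c where "c = \<alpha> * real q / p"
  have q0: "0 < real q" using q by simp
  have c: "0 \<le> c" using p \<alpha> by (auto simp: c_def)
  have "filterlim (\<lambda>\<delta>. \<delta> / real q) (at_right 0) (at_right 0)"
    using q0 by real_asymp
  note layer = filterlim_compose[OF layer_integral_log_asymptotics[OF c] this]
  have ratio: "((\<lambda>\<delta>. ln (1 / (\<delta> / real q)) / \<bar>ln \<delta>\<bar>) \<longlongrightarrow> 1) (at_right 0)"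
    using q0 by real_asymp
  have "((\<lambda>\<delta>. 4 / (real q * (1 - \<alpha> * (1 - \<delta>)))
      * (layer_integral (1 + c * (\<delta> / real q)) (\<delta> / real q) / (\<delta> / real q * ln (1 / (\<delta> / real q)))
        * (ln (1 / (\<delta> / real q)) / \<bar>ln \<delta>\<bar>)))
      \<longlongrightarrow> 4 / (real q * (1 - \<alpha> * (1 - 0))) * (1 * 1)) (at_right 0)"
    using q0 \<alpha> by (intro tendsto_intros layer ratio) auto
  moreover have "\<forall>\<^sub>F \<delta> in at_right 0. 4 / (real q * (1 - \<alpha> * (1 - \<delta>)))
      * (layer_integral (1 + c * (\<delta> / real q)) (\<delta> / real q) / (\<delta> / real q * ln (1 / (\<delta> / real q)))
        * (ln (1 / (\<delta> / real q)) / \<bar>ln \<delta>\<bar>)) = inverse \<bar>ln \<delta>\<bar> * mass \<delta>"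
  proof (rule eventually_at_rightI[of 0 1])
    fix \<delta> :: real assume \<delta>: "\<delta> \<in> {0<..<1}"
    have "1 \<le> real q" using q by simp
    then have "1 < 1 / (\<delta> / real q)" using \<delta> by simp
    then have ln0: "0 < ln (1 / (\<delta> / real q))" by (rule ln_gt_zero)
    have "(1 - \<alpha> * (1 - \<delta>)) / p = 1 + c * (\<delta> / real q)"
      using p q0 by (simp add: p_eq c_def field_simps)
    then have m: "mass \<delta> = 4 / (\<delta> * (1 - \<alpha> * (1 - \<delta>))) * layer_integral (1 + c * (\<delta> / real q)) (\<delta> / real q)"
      by (simp add: mass_def)
    have "A / (real q * D) * (M / (\<delta> / real q * L) * (L / l)) = inverse l * (A / (\<delta> * D) * M)"
      if "L \<noteq> 0" for A D M L l :: real
      using that q0 \<delta> by (simp add: field_simps)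
    from this[OF less_imp_neq[OF ln0, symmetric]]
    show "4 / (real q * (1 - \<alpha> * (1 - \<delta>)))
      * (layer_integral (1 + c * (\<delta> / real q)) (\<delta> / real q) / (\<delta> / real q * ln (1 / (\<delta> / real q)))
        * (ln (1 / (\<delta> / real q)) / \<bar>ln \<delta>\<bar>)) = inverse \<bar>ln \<delta>\<bar> * mass \<delta>"
      unfolding m .
  qed simp
  ultimately show ?thesis
    by (auto simp: p_eq mult.commute elim: Lim_transform_eventually)
qed

text \<open>At \<open>\<delta> = 0\<close> the main term is integrable, and it dominates the main terms for all \<open>\<delta> > 0\<close> because its
  bases are at most \<open>1\<close>. The limit is positive for nonnegative \<open>\<phi>\<close> since \<open>\<bar>F\<bar>\<close> vanishes only on a null set
  and \<open>\<phi>\<close> is positive on a nonempty open set.\<close>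

lemma zeta_limit_subcritical:
  fixes \<phi> :: "real \<times> real \<Rightarrow> real"
  assumes p_less: "p < 1 - \<alpha>" and cont: "continuous_on UNIV \<phi>"
    and B: "0 \<le> B" "\<And>z. \<bar>\<phi> z\<bar> \<le> B" and supp: "\<And>z. z \<notin> square \<Longrightarrow> \<phi> z = 0"
  shows "(zeta \<phi> \<longlongrightarrow> zeta \<phi> 0) (at_right 0)"
    and "\<lbrakk>\<And>z. 0 \<le> \<phi> z; 0 < \<phi> (0, 0)\<rbrakk> \<Longrightarrow> 0 < zeta \<phi> 0"
proof -
  have \<phi> [measurable]: "\<phi> \<in> borel_measurable borel"
    using cont by (rule borel_measurable_continuous_onI)
  obtain C where C: "0 \<le> C"
    "\<And>x y \<sigma>. \<lbrakk>0 < \<bar>x\<bar>; \<bar>x\<bar> \<le> 1; 0 < \<bar>y\<bar>; \<bar>y\<bar> \<le> 1; - 1 / real b \<le> \<sigma>; \<sigma> < 0\<rbrakk>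
       \<Longrightarrow> \<bar>\<bar>F (x, y)\<bar> powr \<sigma> - main_term \<sigma> (x, y)\<bar> \<le> error_bound C (x, y)"
    using abs_F_powr_near_monomial by blast
  define D where "D = (\<lambda>z. B * (indicator square z * error_bound C z + main_term (- 1 / real b) z))"
  have D_int: "integrable lborel D"
    unfolding D_def using p_less
    by (intro integrable_mult_right Bochner_Integration.integrable_add integrable_error_bound
        integrable_main_term_critical)
  have bound: "norm (\<bar>F z\<bar> powr ((\<delta> - 1) / real b) * \<phi> z) \<le> D z"
    if nz: "fst z \<noteq> 0 \<and> snd z \<noteq> 0" and \<delta>: "0 \<le> \<delta>" "\<delta> < 1" for z \<delta>
  proof (cases "z \<in> square")
    case True
    obtain x y where z: "z = (x, y)" by (cases z)
    have \<sigma>: "- 1 / real b \<le> (\<delta> - 1) / real b" "(\<delta> - 1) / real b < 0"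
      using \<delta> b_pos by (auto simp: field_simps)
    have "\<bar>\<bar>F z\<bar> powr ((\<delta> - 1) / real b) - main_term ((\<delta> - 1) / real b) z\<bar> \<le> error_bound C z"
      using C(2)[of x y "(\<delta> - 1) / real b"] True nz \<sigma> by (simp add: z square_def)
    then have "\<bar>F z\<bar> powr ((\<delta> - 1) / real b) \<le> error_bound C z + main_term (- 1 / real b) z"
      using main_term_le_critical[OF \<sigma>(1), of z] by linarith
    then have "\<bar>F z\<bar> powr ((\<delta> - 1) / real b) * \<bar>\<phi> z\<bar>
        \<le> (error_bound C z + main_term (- 1 / real b) z) * B"
      using B error_bound_nonneg[OF C(1), of z] main_term_nonneg[of "- 1 / real b" z]
      by (intro mult_mono) auto
    then show ?thesis
      using True by (simp add: D_def abs_mult mult.commute)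
  next
    case False
    then show ?thesis using supp B(1) C(1) error_bound_nonneg main_term_nonneg
      by (simp add: D_def)
  qed
  show "(zeta \<phi> \<longlongrightarrow> zeta \<phi> 0) (at_right 0)"
  proof (rule tendsto_at_right_sequentially[of 0 1])
    fix S :: "nat \<Rightarrow> real"
    assume S: "\<And>n. 0 < S n" "\<And>n. S n < 1" "S \<longlonglongrightarrow> 0"
    show "(\<lambda>n. zeta \<phi> (S n)) \<longlonglongrightarrow> zeta \<phi> 0"
      unfolding zeta_def
    proof (rule integral_dominated_convergence[OF _ _ D_int])
      show "AE z in lborel. (\<lambda>n. \<bar>F z\<bar> powr ((S n - 1) / real b) * \<phi> z)
          \<longlonglongrightarrow> \<bar>F z\<bar> powr ((0 - 1) / real b) * \<phi> z"
        using AE_lborel_pair_nonzero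
      proof eventually_elim
        case (elim z)
        then have "F z \<noteq> 0" by (cases z) (simp add: F_nonzero)
        then show ?case by (intro tendsto_intros S) (use b_pos in auto)
      qed
      show "AE z in lborel. norm (\<bar>F z\<bar> powr ((S n - 1) / real b) * \<phi> z) \<le> D z" for n
        using AE_lborel_pair_nonzero
      proof eventually_elim
        case (elim z)
        show ?case by (rule bound[OF elim less_imp_le[OF S(1)] S(2)])
      qed
    qed measurable
  qed simp
  assume nonneg: "\<And>z. 0 \<le> \<phi> z" and pos: "0 < \<phi> (0, 0)"
  have int: "integrable lborel (\<lambda>z. \<bar>F z\<bar> powr ((0 - 1) / real b) * \<phi> z)"
    using D_int
  proof (rule Bochner_Integration.integrable_bound)
    show "AE z in lborel. norm (\<bar>F z\<bar> powr ((0 - 1) / real b) * \<phi> z) \<le> norm (D z)"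
      using AE_lborel_pair_nonzero
    proof eventually_elim
      case (elim z)
      from bound[OF elim, of 0] show ?case by simp
    qed
  qed measurable
  have "zeta \<phi> 0 \<noteq> 0"
  proof
    assume "zeta \<phi> 0 = 0"
    then have "AE z in lborel. \<bar>F z\<bar> powr ((0 - 1) / real b) * \<phi> z = 0"
      using integral_nonneg_eq_0_iff_AE[OF int] nonneg by (simp add: zeta_def)
    with AE_lborel_pair_nonzero have "AE z in lborel. \<phi> z = 0"
    proof eventually_elim
      case (elim z)
      then have "F z \<noteq> 0" by (cases z) (simp add: F_nonzero)
      then show ?case using elim by simp
    qed
    moreover have op: "open {z. \<phi> z \<noteq> 0}"
      using cont by (intro open_Collect_neq continuous_on_const)
    ultimately have "{z. \<phi> z \<noteq> 0} \<in> null_sets lborel"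
      using AE_iff_null_sets[of "{z. \<phi> z \<noteq> 0}" lborel] by simp
    then have "negligible {z. \<phi> z \<noteq> 0}"
      by (simp add: negligible_iff_null_sets null_sets_completionI)
    moreover have "{z. \<phi> z \<noteq> 0} \<noteq> {}" using pos by force
    ultimately show False using op open_not_negligible by blast
  qed
  moreover have "0 \<le> zeta \<phi> 0"
    unfolding zeta_def using nonneg by (intro integral_nonneg_AE AE_I2) auto
  ultimately show "0 < zeta \<phi> 0" by linarith
qed

end

section \<open>The limits at the abscissa of convergence\<close>

theorem theorem3p4:
  fixes a b q q' :: nat and p p' :: real and f :: "real \<times> real \<Rightarrow> real"
  assumes "2 \<le> a" and "a < b"
    and "0 < p" and "0 < p'"
    and "even q" and "2 \<le> q" and "q \<le> b"
    and "even q'" and "2 \<le> q'" and "q' \<le> a"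
  defines "f \<equiv> flat_perturbed_monomial a b p p' q q'"
  shows "\<exists>r>0. \<forall>U \<phi>. open U \<and> (0, 0) \<in> U \<and> U \<subseteq> ball (0, 0) r \<and> \<phi> \<in> test_functions U \<longrightarrow>
    (\<forall>s. Re s > - 1 / real b \<longrightarrow>
       integrable lborel (\<lambda>z. complex_of_real \<bar>f z\<bar> powr s * complex_of_real (\<phi> z))) \<and>
    local_zeta f \<phi> holomorphic_on {s. Re s > - 1 / real b} \<and>
    (p > 1 - real a / real b \<longrightarrow>
       ((\<lambda>\<sigma>::real. complex_of_real ((real b * \<sigma> + 1) powr (1 - (1 - real a / real b) / p))
                     * local_zeta f \<phi> (complex_of_real \<sigma>))
         \<longlongrightarrow> complex_of_real
               (4 * (1 / (real q powr ((1 - real a / real b) / p) * (1 - real a / real b))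
                     * Gamma (1 - (1 - real a / real b) / p)) * \<phi> (0, 0)))
       (at_right (- 1 / real b))) \<and>
    (p = 1 - real a / real b \<longrightarrow>
       ((\<lambda>\<sigma>::real. complex_of_real (inverse \<bar>ln (real b * \<sigma> + 1)\<bar>)
                     * local_zeta f \<phi> (complex_of_real \<sigma>))
         \<longlongrightarrow> complex_of_real (4 / (p * real q) * \<phi> (0, 0)))
       (at_right (- 1 / real b))) \<and>
    (p < 1 - real a / real b \<longrightarrow>
       (\<exists>C::real.
          ((\<lambda>\<sigma>::real. local_zeta f \<phi> (complex_of_real \<sigma>)) \<longlongrightarrow> complex_of_real C)
            (at_right (- 1 / real b)) \<and>
          (\<phi> (0, 0) > 0 \<and> (\<forall>z\<in>U. \<phi> z \<ge> 0) \<longrightarrow> C > 0)))"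
proof -
  interpret Z: flat_perturbation a b q q' p p'
    by standard (use assms in auto)
  have f: "f = flat_perturbed_monomial a b p p' q q'" by (simp add: f_def)
  have \<alpha>: "real a / real b = Z.\<alpha>" by (simp add: Z.\<alpha>_def)
  have shift: "filterlim (\<lambda>\<sigma>. real b * \<sigma> + 1) (at_right 0) (at_right (- 1 / real b))"
  proof -
    have "((\<lambda>\<sigma>. real b * \<sigma> + 1) \<longlongrightarrow> real b * (- 1 / real b) + 1) (at_right (- 1 / real b))"
      by (intro tendsto_intros)
    moreover have "\<forall>\<^sub>F \<sigma> in at_right (- 1 / real b). real b * \<sigma> + 1 > 0"
      using Z.b_pos by (auto simp: eventually_at_right_field field_simps intro!: exI[of _ 0])
    ultimately show ?thesis
      using Z.b_pos by (intro tendsto_imp_filterlim_at_right) auto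
  qed
  show ?thesis
    unfolding \<alpha>
  \<comment> \<open>The unit ball lies in the square on which all estimates hold.\<close>
  proof (rule exI[of _ 1], intro conjI allI impI; (elim conjE)?)
    fix U :: "(real \<times> real) set" and \<phi> :: "real \<times> real \<Rightarrow> real"
    assume U: "U \<subseteq> ball (0, 0) 1" and \<phi>: "\<phi> \<in> test_functions U"
    have cont: "continuous_on UNIV \<phi>" using \<phi> by (rule test_function_continuous)
    have meas: "\<phi> \<in> borel_measurable borel" using cont by (rule borel_measurable_continuous_onI)
    obtain B where B: "0 \<le> B" "\<And>z. \<bar>\<phi> z\<bar> \<le> B" using test_function_bounded[OF \<phi>] by blast
    have supp: "\<phi> z = 0" if "z \<notin> square" for z
    proof (rule test_function_eq_0[OF \<phi>])
      have "U \<subseteq> square"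
      proof
        fix z assume "z \<in> U"
        then have "norm z < 1" using U by (auto simp: zero_prod_def[symmetric])
        then show "z \<in> square"
          using norm_fst_le[of "fst z" "snd z"] norm_snd_le[of "snd z" "fst z"]
          by (cases z) (auto simp: square_def)
      qed
      then show "z \<notin> U" using that by blast
    qed
    have int: "integrable lborel (\<lambda>z. complex_of_real \<bar>f z\<bar> powr s * complex_of_real (\<phi> z))"
      if "- 1 / real b < Re s" for s
      unfolding f using that meas B supp by (rule Z.integrable_zeta_integrand)
    have limit: "((\<lambda>\<delta>. N \<delta> * Z.zeta \<phi> \<delta>) \<longlongrightarrow> c * \<phi> (0, 0)) (at_right 0)"
      if "\<And>\<delta>. 0 \<le> N \<delta>" "(N \<longlongrightarrow> 0) (at_right 0)" "((\<lambda>\<delta>. N \<delta> * Z.mass \<delta>) \<longlongrightarrow> c) (at_right 0)" for N c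
      using cont B supp that by (rule Z.normalized_zeta_limit)
    have transfer_limit: "((\<lambda>\<sigma>. complex_of_real (N (real b * \<sigma> + 1)) * local_zeta f \<phi> (complex_of_real \<sigma>))
        \<longlongrightarrow> complex_of_real c) (at_right (- 1 / real b))"
      if "((\<lambda>\<delta>. N \<delta> * Z.zeta \<phi> \<delta>) \<longlongrightarrow> c) (at_right 0)" for N c
      using tendsto_of_real[OF filterlim_compose[OF that shift]]
      unfolding f Z.local_zeta_real by simp
    {
      fix s :: complex assume "- 1 / real b < Re s"
      then show "integrable lborel (\<lambda>z. complex_of_real \<bar>f z\<bar> powr s * complex_of_real (\<phi> z))"
        by (rule int)
    next
      show "local_zeta f \<phi> holomorphic_on {s. - 1 / real b < Re s}"
        unfolding local_zeta_def[abs_def]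
        by (rule holomorphic_on_integral_powr[OF _ _ int]) (simp_all add: f)
    next
      assume p_gt: "1 - Z.\<alpha> < p"
      define k where "k = 1 - (1 - Z.\<alpha>) / p"
      have k: "0 < k" using p_gt Z.p by (simp add: k_def)
      have "((\<lambda>\<delta>. \<delta> powr k) \<longlongrightarrow> 0) (at_right 0)"
        using k by real_asymp
      from transfer_limit[OF limit[OF powr_ge_zero this Z.mass_power_asymptotics[OF p_gt, folded k_def]]]
      show "((\<lambda>\<sigma>. complex_of_real ((real b * \<sigma> + 1) powr (1 - (1 - Z.\<alpha>) / p))
          * local_zeta f \<phi> (complex_of_real \<sigma>))
         \<longlongrightarrow> complex_of_real (4 * (1 / (real q powr ((1 - Z.\<alpha>) / p) * (1 - Z.\<alpha>))
              * Gamma (1 - (1 - Z.\<alpha>) / p)) * \<phi> (0, 0))) (at_right (- 1 / real b))"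
        by (simp add: k_def)
    next
      assume p_eq: "p = 1 - Z.\<alpha>"
      have "((\<lambda>\<delta>::real. inverse \<bar>ln \<delta>\<bar>) \<longlongrightarrow> 0) (at_right 0)"
        by real_asymp
      from transfer_limit[OF limit[OF inverse_nonnegative_iff_nonnegative[THEN iffD2, OF abs_ge_zero] this Z.mass_log_asymptotics[OF p_eq]]]
      show "((\<lambda>\<sigma>. complex_of_real (inverse \<bar>ln (real b * \<sigma> + 1)\<bar>) * local_zeta f \<phi> (complex_of_real \<sigma>))
         \<longlongrightarrow> complex_of_real (4 / (p * real q) * \<phi> (0, 0))) (at_right (- 1 / real b))"
        by simp
    next
      assume p_less: "p < 1 - Z.\<alpha>"
      have "(Z.zeta \<phi> \<longlongrightarrow> Z.zeta \<phi> 0) (at_right 0)"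
        using p_less cont B supp by (rule Z.zeta_limit_subcritical(1))
      then have "((\<lambda>\<sigma>. local_zeta f \<phi> (complex_of_real \<sigma>)) \<longlongrightarrow> complex_of_real (Z.zeta \<phi> 0))
          (at_right (- 1 / real b))"
        using transfer_limit[of "\<lambda>_. 1"] by simp
      moreover have "0 < Z.zeta \<phi> 0" if "0 < \<phi> (0, 0)" "\<forall>z\<in>U. 0 \<le> \<phi> z"
      proof (rule Z.zeta_limit_subcritical(2)[OF p_less cont B supp])
        show "0 \<le> \<phi> z" for z
          using that(2) test_function_eq_0[OF \<phi>, of z] by (cases "z \<in> U") auto
      qed (use that in auto)
      ultimately show "\<exists>C. ((\<lambda>\<sigma>. local_zeta f \<phi> (complex_of_real \<sigma>)) \<longlongrightarrow> complex_of_real C)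
            (at_right (- 1 / real b)) \<and>
          (0 < \<phi> (0, 0) \<and> (\<forall>z\<in>U. 0 \<le> \<phi> z) \<longrightarrow> 0 < C)"
        by blast
    }
  qed simp
qed

end
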